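(* Let $\beta \approx -2.0391$ be the smallest real root of $x^6-3x^5-7x^4+21x^3+13x^2-35x-4$. Let $\hat{\eta}_3$ be the supremum of the smallest eigenvalues of all $3$-regular graphs whose smallest eigenvalue is less than $-2$. Then $\hat{\eta}_3 = \beta$, and up to isomorphism there is exactly one connected $3$-regular graph whose smallest eigenvalue equals $\beta$.
   Context: All graphs are finite, undirected, without loops and without multiple edges. The eigenvalues of a graph are the eigenvalues of its adjacency matrix. A graph is $3$-regular if every vertex has exactly $3$ neighbours. *)

theory Defs
  imports
    "Graph_Theory.Graph_Theory"
    "Jordan_Normal_Form.Char_Poly"
    "HOL-Library.Infinite_Typeclass"
begin

(* Finite simple graphs are the pair_graph structures of Graph_Theory: finite, loop-free,
   symmetric, arcs given as ordered pairs of vertices (an edge is a pair of opposite arcs).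
   "All graphs" is rendered as all such graphs over a vertex type of class infinite, which
   contains a copy of every finite graph. *)

(* The null graph is excluded: it has no eigenvalues, and so no smallest one. *)
definition regular_graph :: "nat \<Rightarrow> 'a pair_pre_digraph \<Rightarrow> bool" where
  "regular_graph k G \<longleftrightarrow>
     pair_graph G \<and> pverts G \<noteq> {} \<and> (\<forall>v \<in> pverts G. card {u. (v, u) \<in> parcs G} = k)"

definition adjacency_matrix :: "'a pair_pre_digraph \<Rightarrow> 'a list \<Rightarrow> real mat" where
  "adjacency_matrix G vs =
     mat (length vs) (length vs) (\<lambda>(i, j). if (vs ! i, vs ! j) \<in> parcs G then 1 else 0)"

(* Different enumerations vs of the vertices give similar matrices, so the quantifier over vs
   only avoids choosing one. The matrix is real symmetric, so all its eigenvalues are real. *)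
definition graph_eigenvalues :: "'a pair_pre_digraph \<Rightarrow> real set" where
  "graph_eigenvalues G =
     {c. \<exists>vs. distinct vs \<and> set vs = pverts G \<and> eigenvalue (adjacency_matrix G vs) c}"

definition smallest_eigenvalue :: "'a pair_pre_digraph \<Rightarrow> real" where
  "smallest_eigenvalue G = Min (graph_eigenvalues G)"

(* The smallest real root of x^6 - 3x^5 - 7x^4 + 21x^3 + 13x^2 - 35x - 4, about -2.0391. *)
definition beta :: real where
  "beta = Min {x. poly [:-4, -35, 13, 21, -7, -3, 1:] x = 0}"

end

(*
  Let G be a cubic graph whose smallest eigenvalue m satisfies beta <= m < -2, take an eigenvector
  of m and a component C on which it does not vanish. If C has no induced claw and no induced
  diamond, then A + 2 I is on C a sum of two equivalence relations, hence positive semidefinite,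
  contradicting m < -2. Otherwise grow an induced claw or diamond inside C by one vertex at a time.
  By interlacing, every induced subgraph must have smallest eigenvalue at least beta; this makes the
  search finite, and it ends with C being one of five graphs on 10 vertices, where A + 2 I is a sum
  of squares, or one graph on 16 vertices, whose only eigenvalue below -2 is beta.
*)

theory Submission
  imports Defs "HOL-Analysis.Function_Topology"
begin

section \<open>The smallest eigenvalue as a Rayleigh quotient\<close>

text \<open>Since \<open>beta\<close> is irrational, the search compares with the slightly smaller
  rational number - 2.0392, and this weaker bound already leaves only the six graphs. The exact
  value comes back at the end from the eigenvector equations of the graph on 16 vertices, whose
  symmetries reduce them to the polynomial of degree 6.

  Claws and diamonds are the starting points because a graph without them is the line graph of a
  triangle-free graph, and line graphs have no eigenvalue below - 2. They do not by themselves force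
  an eigenvalue below - 2: the Petersen graph has induced claws and smallest eigenvalue - 2. So the
  search cannot consist of refutations alone and must also recognise the exceptional graphs.

  A refutation is a single integer vector on the graph grown so far, and checking it is integer
  arithmetic. The same graph may be reached along many branches; each leaf carries its own
  relabelling, so that no isomorphism search takes place.\<close>

lemma symmetric_form_minimizer:
  fixes a :: "'a \<Rightarrow> 'a \<Rightarrow> real"
  assumes V: "finite V" "V \<noteq> {}" and sym: "\<And>u v. a u v = a v u"
  obtains c x where "\<exists>v\<in>V. x v \<noteq> 0"
    and "\<And>v. v \<in> V \<Longrightarrow> (\<Sum>u\<in>V. a v u * x u) = c * x v"
    and "\<And>y. c * (\<Sum>v\<in>V. (y v)\<^sup>2) \<le> (\<Sum>v\<in>V. y v * (\<Sum>u\<in>V. a v u * y u))"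
proof -
  define Q where "Q y = (\<Sum>v\<in>V. y v * (\<Sum>u\<in>V. a v u * y u))" for y
  define N where "N y = (\<Sum>v\<in>V. (y v)\<^sup>2)" for y :: "'a \<Rightarrow> real"
  \<comment> \<open>Vectors on \<open>V\<close> are functions on the whole type, so the unit sphere
    sits in a product over \<open>UNIV\<close>. The value 0 off \<open>V\<close> makes the box
    compact, and every unit vector on \<open>V\<close> lies in it.\<close>
  define K where "K = PiE UNIV (\<lambda>v. if v \<in> V then {-1..1} else {0::real})"
  have coord: "continuous_on UNIV (\<lambda>y::'a \<Rightarrow> real. y v)" for v
    by (rule continuous_on_product_coordinates)
  have contQ: "continuous_on UNIV Q" and contN: "continuous_on UNIV N"
    unfolding Q_def N_def by (intro continuous_intros coord)+
  have "compactin (product_topology (\<lambda>_. euclidean) UNIV) K"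
    unfolding K_def by (subst compactin_PiE) auto
  then have "compact K"
    by (simp add: euclidean_product_topology)
  moreover have "closed {y. N y = 1}"
    using closed_vimage[of "{1}" N] contN by (simp add: vimage_def)
  ultimately have "compact (K \<inter> {y. N y = 1})"
    by (rule compact_Int_closed)
  moreover have "K \<inter> {y. N y = 1} \<noteq> {}"
  proof -
    obtain w where w: "w \<in> V" using V by blast
    have "N (\<lambda>v. if v = w then 1 else 0) = (\<Sum>v\<in>V. if v = w then 1 else 0)"
      unfolding N_def by (intro sum.cong) auto
    then have "N (\<lambda>v. if v = w then 1 else 0) = 1"
      using w V by simp
    moreover have "(\<lambda>v. if v = w then 1 else 0) \<in> K"
      using w by (auto simp: K_def PiE_def)
    ultimately show ?thesis by blast
  qed
  ultimately obtain x where x: "x \<in> K" "N x = 1"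
    and min: "\<And>y. y \<in> K \<Longrightarrow> N y = 1 \<Longrightarrow> Q x \<le> Q y"
    using continuous_attains_inf[of "K \<inter> {y. N y = 1}" Q] continuous_on_subset[OF contQ]
    by auto
  have rayleigh: "Q x * N y \<le> Q y" for y
  proof (cases "N y = 0")
    case True
    then have "\<And>v. v \<in> V \<Longrightarrow> y v = 0"
      using V by (simp add: N_def sum_nonneg_eq_0_iff)
    then have "Q y = 0" by (simp add: Q_def)
    then show ?thesis using True by simp
  next
    case False
    then have pos: "N y > 0"
      by (simp add: N_def order_less_le sum_nonneg)
    define z where "z v = (if v \<in> V then y v / sqrt (N y) else 0)" for v
    have Nz: "N z = 1"
    proof -
      have "N z = (\<Sum>v\<in>V. (y v)\<^sup>2 / N y)"
        unfolding N_def[of z] using pos by (intro sum.cong) (auto simp: z_def power_divide)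
      also have "\<dots> = N y / N y"
        by (simp only: N_def sum_divide_distrib)
      finally show ?thesis using pos by simp
    qed
    have Qz: "Q z = Q y / N y"
    proof -
      have "Q z = (\<Sum>v\<in>V. \<Sum>u\<in>V. y v * (a v u * y u) / N y)"
        unfolding Q_def sum_distrib_left using pos
        by (intro sum.cong) (auto simp: z_def field_simps)
      then show ?thesis
        by (simp add: Q_def sum_distrib_left sum_divide_distrib)
    qed
    have "z v \<in> {-1..1}" if "v \<in> V" for v
    proof -
      have "(z v)\<^sup>2 \<le> N z"
        unfolding N_def using V that by (intro member_le_sum) auto
      then show ?thesis
        using Nz abs_square_le_1[of "z v"] by (auto simp: abs_le_iff)
    qed
    then have "z \<in> K"
      by (auto simp: K_def PiE_def z_def)
    from min[OF this Nz] show ?thesis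
      using pos by (simp add: Qz field_simps)
  qed
  \<comment> \<open>The eigenvector equation is the first-order condition at the minimum: along
    \<open>x + t e\<close> the Rayleigh inequality reads \<open>0 <= 2 t g + t^2 h\<close>, which
    fails for some \<open>t\<close> unless \<open>g = 0\<close>.\<close>
  have "(\<Sum>u\<in>V. a w u * x u) = Q x * x w" if w: "w \<in> V" for w
  proof (rule ccontr)
    define g where "g = (\<Sum>u\<in>V. a w u * x u) - Q x * x w"
    define h where "h = a w w - Q x"
    assume "\<not> ?thesis"
    then have g: "g \<noteq> 0" by (simp add: g_def)
    define e where "e v = (if v = w then 1 else 0 :: real)" for v
    have se: "(\<Sum>v\<in>V. f v * e v) = f w" for f
      using w V by (simp add: e_def if_distrib cong: if_cong)
    have quad: "0 \<le> 2 * t * g + t\<^sup>2 * h" for t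
    proof -
      have "Q (\<lambda>v. x v + t * e v) = Q x + t * (\<Sum>v\<in>V. x v * (\<Sum>u\<in>V. a v u * e u))
          + t * (\<Sum>v\<in>V. (\<Sum>u\<in>V. a v u * x u) * e v)
          + t\<^sup>2 * (\<Sum>v\<in>V. (\<Sum>u\<in>V. a v u * e u) * e v)"
        unfolding Q_def
        by (simp add: algebra_simps sum.distrib sum_distrib_left power2_eq_square)
      also have "\<dots> = Q x + 2 * t * (\<Sum>u\<in>V. a w u * x u) + t\<^sup>2 * a w w"
      proof -
        have "(\<Sum>v\<in>V. x v * a v w) = (\<Sum>u\<in>V. a w u * x u)"
          by (intro sum.cong refl) (subst sym, simp)
        then show ?thesis unfolding se by simp
      qed
      finally have 1: "Q (\<lambda>v. x v + t * e v) = Q x + 2 * t * (\<Sum>u\<in>V. a w u * x u) + t\<^sup>2 * a w w" .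
      have "N (\<lambda>v. x v + t * e v) = N x + 2 * t * (\<Sum>v\<in>V. x v * e v) + t\<^sup>2 * (\<Sum>v\<in>V. e v * e v)"
        unfolding N_def
        by (simp add: algebra_simps sum.distrib sum_distrib_left power2_eq_square)
      also have "\<dots> = 1 + 2 * t * x w + t\<^sup>2"
        unfolding se by (simp add: x e_def)
      finally have 2: "N (\<lambda>v. x v + t * e v) = 1 + 2 * t * x w + t\<^sup>2" .
      show ?thesis
        using rayleigh[of "\<lambda>v. x v + t * e v"] unfolding 1 2 g_def h_def
        by (simp add: algebra_simps)
    qed
    \<comment> \<open>For \<open>h > 0\<close> the quadratic is smallest at
      \<open>t = - g / h\<close>; taking \<open>max 1 h\<close> instead of \<open>h\<close> also
      covers \<open>h <= 0\<close>.\<close>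
    obtain k :: real where k: "k > 0" "h < 2 * k"
    proof
      show "max 1 h > 0" "h < 2 * max 1 h" by (auto simp: max_def)
    qed
    have "2 * (- g / k) * g + (- g / k)\<^sup>2 * h = (g / k)\<^sup>2 * (h - 2 * k)"
      using k(1) by (simp add: field_simps power2_eq_square)
    also have "\<dots> < 0"
      using k g by (intro mult_pos_neg) auto
    finally show False
      using quad[of "- g / k"] by simp
  qed
  moreover have "\<exists>v\<in>V. x v \<noteq> 0"
    using x(2) by (auto simp: N_def intro: ccontr)
  ultimately show thesis
    using that[of x "Q x"] rayleigh by (simp add: Q_def N_def)
qed

section \<open>Graph eigenvalues through functions on the vertices\<close>

definition nbr :: "'a pair_pre_digraph \<Rightarrow> 'a \<Rightarrow> 'a set" where
  "nbr G v = {u. (v, u) \<in> parcs G}"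

definition adj_form :: "'a pair_pre_digraph \<Rightarrow> ('a \<Rightarrow> real) \<Rightarrow> real" where
  "adj_form G x = (\<Sum>v\<in>pverts G. x v * (\<Sum>u\<in>nbr G v. x u))"

lemma nbr_subset: "pair_graph G \<Longrightarrow> nbr G v \<subseteq> pverts G"
  using pair_wf_digraph.in_arcsD2[of G]
  by (auto simp: nbr_def pair_graph_def pair_digraph_def pair_fin_digraph_def)

lemma finite_pverts: "pair_graph G \<Longrightarrow> finite (pverts G)"
  by (simp add: pair_graph_def pair_digraph_def pair_fin_digraph_def pair_fin_digraph_axioms_def)

lemma finite_nbr: "pair_graph G \<Longrightarrow> finite (nbr G v)"
  using finite_subset nbr_subset finite_pverts by metis

lemma arcs_sym: "pair_graph G \<Longrightarrow> (u, v) \<in> parcs G \<Longrightarrow> (v, u) \<in> parcs G"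
  using pair_sym_digraph.pair_sym_arcs[of G]
  by (auto simp: pair_graph_def pair_pseudo_graph_def symmetric_def sym_def)

lemma arcs_irrefl: "pair_graph G \<Longrightarrow> (u, u) \<notin> parcs G"
  using pair_loopfree_digraph.pair_no_loops[of G "(u, u)"]
  by (auto simp: pair_graph_def pair_digraph_def)

lemma nbr_sum_eq_adjacency_row:
  assumes G: "pair_graph G" and vs: "distinct vs" "set vs = pverts G" and i: "i < length vs"
  shows "(\<Sum>u\<in>nbr G (vs ! i). x u) =
    row (adjacency_matrix G vs) i \<bullet> vec (length vs) (\<lambda>j. x (vs ! j))"
proof -
  have "(\<Sum>u\<in>nbr G (vs ! i). x u) = (\<Sum>u\<in>set vs. if (vs ! i, u) \<in> parcs G then x u else 0)"
    using nbr_subset[OF G, of "vs ! i"] vs finite_pverts[OF G]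
    by (intro sum.mono_neutral_cong_left) (auto simp: nbr_def)
  also have "\<dots> = (\<Sum>j<length vs. if (vs ! i, vs ! j) \<in> parcs G then x (vs ! j) else 0)"
    using vs by (intro sum.reindex_bij_betw[symmetric] bij_betw_nth) auto
  also have "\<dots> = row (adjacency_matrix G vs) i \<bullet> vec (length vs) (\<lambda>j. x (vs ! j))"
    using i by (auto simp: scalar_prod_def adjacency_matrix_def atLeast0LessThan intro!: sum.cong)
  finally show ?thesis .
qed

text \<open>The right-hand side does not mention \<open>vs\<close>: read as functions on the
  vertices, the eigenvectors of all enumerations satisfy the same equations.\<close>

lemma eigenvalue_adjacency_matrix_iff:
  assumes G: "pair_graph G" and vs: "distinct vs" "set vs = pverts G"
  shows "eigenvalue (adjacency_matrix G vs) c \<longleftrightarrow>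
    (\<exists>x. (\<exists>v\<in>pverts G. x v \<noteq> 0) \<and> (\<forall>v\<in>pverts G. (\<Sum>u\<in>nbr G v. x u) = c * x v))"
proof
  assume "eigenvalue (adjacency_matrix G vs) c"
  then obtain w where w: "dim_vec w = length vs" "w \<noteq> 0\<^sub>v (length vs)"
    "adjacency_matrix G vs *\<^sub>v w = c \<cdot>\<^sub>v w"
    by (auto simp: eigenvalue_def eigenvector_def adjacency_matrix_def dest: carrier_vecD)
  define x where "x v = w $ (the_inv_into {..<length vs} ((!) vs) v)" for v
  have x: "x (vs ! i) = w $ i" if "i < length vs" for i
    using that vs by (simp add: x_def the_inv_into_f_f inj_on_nth)
  have wx: "w = vec (length vs) (\<lambda>j. x (vs ! j))"
    using w(1) x by (intro eq_vecI) auto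
  have "(\<Sum>u\<in>nbr G (vs ! i). x u) = c * x (vs ! i)" if "i < length vs" for i
  proof -
    have "(adjacency_matrix G vs *\<^sub>v w) $ i = c * w $ i"
      using w that by simp
    then show ?thesis
      using that nbr_sum_eq_adjacency_row[OF G vs that, of x, folded wx] x
      by (simp add: adjacency_matrix_def)
  qed
  then have "\<forall>v\<in>pverts G. (\<Sum>u\<in>nbr G v. x u) = c * x v"
    using vs by (metis in_set_conv_nth)
  moreover have "\<exists>i<length vs. w $ i \<noteq> 0"
    using w(1,2) by (auto simp: vec_eq_iff)
  then have "\<exists>v\<in>pverts G. x v \<noteq> 0"
    using x vs by (metis nth_mem)
  ultimately show "\<exists>x. (\<exists>v\<in>pverts G. x v \<noteq> 0) \<and> (\<forall>v\<in>pverts G. (\<Sum>u\<in>nbr G v. x u) = c * x v)"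
    by blast
next
  assume "\<exists>x. (\<exists>v\<in>pverts G. x v \<noteq> 0) \<and> (\<forall>v\<in>pverts G. (\<Sum>u\<in>nbr G v. x u) = c * x v)"
  then obtain x where x: "\<exists>v\<in>pverts G. x v \<noteq> 0" "\<forall>v\<in>pverts G. (\<Sum>u\<in>nbr G v. x u) = c * x v"
    by blast
  let ?w = "vec (length vs) (\<lambda>j. x (vs ! j))"
  have "adjacency_matrix G vs *\<^sub>v ?w = c \<cdot>\<^sub>v ?w"
  proof (rule eq_vecI)
    fix i assume "i < dim_vec (c \<cdot>\<^sub>v ?w)"
    then have i: "i < length vs" by simp
    then show "(adjacency_matrix G vs *\<^sub>v ?w) $ i = (c \<cdot>\<^sub>v ?w) $ i"
      using nbr_sum_eq_adjacency_row[OF G vs i, of x] x(2) vs nth_mem[OF i]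
      by (simp add: adjacency_matrix_def)
  qed (simp add: adjacency_matrix_def)
  moreover have "?w \<noteq> 0\<^sub>v (length vs)"
    using x(1) vs by (auto simp: vec_eq_iff) (metis in_set_conv_nth)
  ultimately show "eigenvalue (adjacency_matrix G vs) c"
    by (auto simp: eigenvalue_def eigenvector_def adjacency_matrix_def intro!: exI[of _ ?w])
qed

lemma graph_eigenvalues_iff:
  assumes G: "pair_graph G"
  shows "c \<in> graph_eigenvalues G \<longleftrightarrow>
    (\<exists>x. (\<exists>v\<in>pverts G. x v \<noteq> 0) \<and> (\<forall>v\<in>pverts G. (\<Sum>u\<in>nbr G v. x u) = c * x v))"
    (is "_ \<longleftrightarrow> ?R")
proof -
  obtain vs where vs: "set vs = pverts G" "distinct vs"
    using finite_distinct_list[OF finite_pverts[OF G]] by blast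
  have iff: "eigenvalue (adjacency_matrix G ws) c \<longleftrightarrow> ?R" if "distinct ws" "set ws = pverts G" for ws
    by (rule eigenvalue_adjacency_matrix_iff[OF G that])
  show ?thesis
  proof
    assume "c \<in> graph_eigenvalues G"
    then show ?R using iff unfolding graph_eigenvalues_def by blast
  next
    assume ?R
    then have "eigenvalue (adjacency_matrix G vs) c" using iff[OF vs(2,1)] by simp
    then show "c \<in> graph_eigenvalues G" using vs unfolding graph_eigenvalues_def by blast
  qed
qed

lemma finite_graph_eigenvalues:
  assumes G: "pair_graph G"
  shows "finite (graph_eigenvalues G)"
proof -
  obtain vs where vs: "set vs = pverts G" "distinct vs"
    using finite_distinct_list[OF finite_pverts[OF G]] by blast
  have A: "adjacency_matrix G vs \<in> carrier_mat (length vs) (length vs)"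
    by (simp add: adjacency_matrix_def)
  have "graph_eigenvalues G = {c. eigenvalue (adjacency_matrix G vs) c}"
    by (simp add: set_eq_iff graph_eigenvalues_iff[OF G] eigenvalue_adjacency_matrix_iff[OF G vs(2,1)])
  then have "graph_eigenvalues G = {c. poly (char_poly (adjacency_matrix G vs)) c = 0}"
    by (simp add: eigenvalue_root_char_poly[OF A])
  moreover have "char_poly (adjacency_matrix G vs) \<noteq> 0"
    using degree_monic_char_poly[OF A] by auto
  ultimately show ?thesis
    by (simp add: poly_roots_finite)
qed

text \<open>The minimum \<open>c\<close> of the Rayleigh quotient is itself an eigenvalue, so
  \<open>smallest_eigenvalue G <= c\<close>, and the Rayleigh bound for \<open>c\<close> passes down
  to it.\<close>

lemma smallest_eigenvalue:
  assumes G: "pair_graph G" "pverts G \<noteq> {}"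
  shows smallest_eigenvalue_in: "smallest_eigenvalue G \<in> graph_eigenvalues G"
    and smallest_eigenvalue_rayleigh:
      "smallest_eigenvalue G * (\<Sum>v\<in>pverts G. (y v)\<^sup>2) \<le> adj_form G y"
proof -
  define a where "a v u = (if (v, u) \<in> parcs G then 1 else 0 :: real)" for v u
  have a: "(\<Sum>u\<in>pverts G. a v u * y u) = (\<Sum>u\<in>nbr G v. y u)" for y v
    using nbr_subset[OF G(1)] finite_pverts[OF G(1)] unfolding nbr_def a_def
    by (intro sum.mono_neutral_cong_right) auto
  have sym: "a u v = a v u" for u v
    using arcs_sym[OF G(1)] by (auto simp: a_def)
  obtain c x where c: "\<exists>v\<in>pverts G. x v \<noteq> 0"
    "\<And>v. v \<in> pverts G \<Longrightarrow> (\<Sum>u\<in>pverts G. a v u * x u) = c * x v"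
    "\<And>y. c * (\<Sum>v\<in>pverts G. (y v)\<^sup>2) \<le> (\<Sum>v\<in>pverts G. y v * (\<Sum>u\<in>pverts G. a v u * y u))"
    using finite_pverts[OF G(1)] G(2) sym by (rule symmetric_form_minimizer[of "pverts G" a]) (rule that)
  then have in_ev: "c \<in> graph_eigenvalues G"
    by (auto simp: graph_eigenvalues_iff[OF G(1)] a)
  then show "smallest_eigenvalue G \<in> graph_eigenvalues G"
    unfolding smallest_eigenvalue_def using finite_graph_eigenvalues[OF G(1)] by (intro Min_in) auto
  have "smallest_eigenvalue G \<le> c"
    unfolding smallest_eigenvalue_def using finite_graph_eigenvalues[OF G(1)] in_ev by simp
  then have "smallest_eigenvalue G * (\<Sum>v\<in>pverts G. (y v)\<^sup>2) \<le> c * (\<Sum>v\<in>pverts G. (y v)\<^sup>2)"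
    by (intro mult_right_mono sum_nonneg) auto
  also have "\<dots> \<le> adj_form G y"
    using c(3) by (simp add: a adj_form_def)
  finally show "smallest_eigenvalue G * (\<Sum>v\<in>pverts G. (y v)\<^sup>2) \<le> adj_form G y" .
qed

section \<open>Cubic graphs without induced claws and diamonds\<close>

text \<open>The matrix of \<open>R\<close> is block diagonal with all-ones blocks, so each class
  contributes the square of the sum of \<open>x\<close> over it.\<close>

lemma equiv_form_nonneg:
  fixes x :: "'a \<Rightarrow> real"
  assumes C: "finite C" and R: "equiv C R"
  shows "0 \<le> (\<Sum>v\<in>C. x v * (\<Sum>u\<in>R `` {v}. x u))"
proof -
  let ?g = "\<lambda>v. x v * (\<Sum>u\<in>R `` {v}. x u)"
  have "sum ?g C = sum ?g (\<Union>(C // R))"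
    using Union_quotient[OF R] by simp
  also have "\<dots> = (\<Sum>B\<in>C // R. sum ?g B)"
    using finite_quotient[OF C] R quotient_disj[OF R] finite_equiv_class[OF C] equiv_type[OF R]
    by (subst sum.Union_disjoint) auto
  also have "\<dots> = (\<Sum>B\<in>C // R. (\<Sum>v\<in>B. x v)\<^sup>2)"
  proof (rule sum.cong[OF refl])
    fix B assume B: "B \<in> C // R"
    have "R `` {v} = B" if "v \<in> B" for v
    proof -
      obtain w where "B = R `` {w}" using B by (rule quotientE)
      then show ?thesis using equiv_class_eq[OF R, of w v] that by simp
    qed
    then show "sum ?g B = (\<Sum>v\<in>B. x v)\<^sup>2"
      by (simp add: power2_eq_square sum_distrib_right)
  qed
  finally show ?thesis by (simp add: sum_nonneg)
qed

definition claw :: "nat list list" where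
  "claw = [[1,2,3],[0],[0],[0]]"

definition diamond :: "nat list list" where
  "diamond = [[1,2],[0,2,3],[0,1,3],[1,2]]"

text \<open>\<open>vs\<close> lists an induced copy in \<open>G\<close> of the graph with adjacency lists \<open>H\<close>.\<close>

definition embeds :: "'a pair_pre_digraph \<Rightarrow> nat list list \<Rightarrow> 'a list \<Rightarrow> bool" where
  "embeds G H vs \<longleftrightarrow> length vs = length H \<and> distinct vs \<and> set vs \<subseteq> pverts G \<and>
     (\<forall>i<length H. distinct (H ! i) \<and> set (H ! i) \<subseteq> {..<length H} \<and>
        nbr G (vs ! i) \<inter> set vs = (!) vs ` set (H ! i))"

lemma regular_graphD:
  assumes "regular_graph k G"
  shows "pair_graph G" "pverts G \<noteq> {}" "v \<in> pverts G \<Longrightarrow> card (nbr G v) = k"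
  using assms by (auto simp: regular_graph_def nbr_def)

lemma nbr_sym: "pair_graph G \<Longrightarrow> u \<in> nbr G v \<longleftrightarrow> v \<in> nbr G u"
  using arcs_sym by (auto simp: nbr_def)

lemma nbr_irrefl: "pair_graph G \<Longrightarrow> v \<notin> nbr G v"
  by (simp add: nbr_def arcs_irrefl)

lemma third_nbr:
  assumes G: "regular_graph 3 G" and v: "v \<in> pverts G"
    and uw: "u \<in> nbr G v" "w \<in> nbr G v" "u \<noteq> w"
  obtains z where "nbr G v = {u, w, z}" "z \<noteq> u" "z \<noteq> w"
proof -
  have "card (nbr G v - {u, w}) = 1"
    using regular_graphD(3)[OF G v] uw by (simp add: card_Diff_subset)
  then obtain z where "nbr G v - {u, w} = {z}"
    by (auto simp: card_1_singleton_iff)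
  then show thesis using uw that[of z] by blast
qed

lemma embeds_clawI:
  assumes G: "pair_graph G" and nbr: "nbr G v = {a, b, c}" and "distinct [a, b, c]"
    and "b \<notin> nbr G a" "c \<notin> nbr G a" "c \<notin> nbr G b"
  shows "embeds G claw [v, a, b, c]"
proof -
  have "v \<in> nbr G a" "v \<in> nbr G b" "v \<in> nbr G c"
    using nbr nbr_sym[OF G] by blast+
  moreover have "a \<notin> nbr G b" "a \<notin> nbr G c" "b \<notin> nbr G c"
    using assms nbr_sym[OF G] by blast+
  moreover have "v \<noteq> a" "v \<noteq> b" "v \<noteq> c"
    using nbr nbr_irrefl[OF G, of v] by auto
  moreover have "{v, a, b, c} \<subseteq> pverts G"
    using nbr_subset[OF G, of a] nbr_subset[OF G, of v] nbr \<open>v \<in> nbr G a\<close> by auto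
  ultimately show ?thesis
    using assms nbr_irrefl[OF G]
    by (auto simp: embeds_def claw_def All_less_Suc2)
qed

lemma embeds_diamondI:
  assumes G: "pair_graph G" and "b \<in> nbr G a" "c \<in> nbr G a" "c \<in> nbr G b" "d \<in> nbr G b" "d \<in> nbr G c"
    and "d \<notin> nbr G a" "a \<noteq> d"
  shows "embeds G diamond [a, b, c, d]"
proof -
  have "a \<in> nbr G b" "a \<in> nbr G c" "b \<in> nbr G c" "b \<in> nbr G d" "c \<in> nbr G d" "a \<notin> nbr G d"
    using assms nbr_sym[OF G] by blast+
  moreover have "a \<noteq> b" "a \<noteq> c" "b \<noteq> c" "b \<noteq> d" "c \<noteq> d"
    using assms nbr_irrefl[OF G] by blast+
  moreover have "{a, b, c, d} \<subseteq> pverts G"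
    using nbr_subset[OF G] calculation assms by blast
  ultimately show ?thesis
    using assms nbr_irrefl[OF G]
    by (auto simp: embeds_def diamond_def All_less_Suc2)
qed

text \<open>In a cubic graph without induced claws and diamonds, the edges in a triangle and the edges
  in no triangle each form, together with the diagonal, an equivalence relation; \<open>A + 2 I\<close> is the
  sum of the two.\<close>

lemma claw_diamond_free_form:
  fixes x :: "'a \<Rightarrow> real"
  assumes G: "regular_graph 3 G" and C: "C \<subseteq> pverts G"
    and closed: "\<And>v. v \<in> C \<Longrightarrow> nbr G v \<subseteq> C"
    and no_claw: "\<And>vs. embeds G claw vs \<Longrightarrow> set vs \<inter> C = {}"
    and no_diamond: "\<And>vs. embeds G diamond vs \<Longrightarrow> set vs \<inter> C = {}"
  shows "- 2 * (\<Sum>v\<in>C. (x v)\<^sup>2) \<le> (\<Sum>v\<in>C. x v * (\<Sum>u\<in>nbr G v. x u))"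
proof -
  note G' = regular_graphD(1)[OF G]
  note sym = nbr_sym[OF G'] and irrefl = nbr_irrefl[OF G']
  have finC: "finite C"
    using C finite_pverts[OF G'] finite_subset by blast
  define tri where "tri u v \<longleftrightarrow> v \<in> nbr G u \<and> nbr G u \<inter> nbr G v \<noteq> {}" for u v
  define R where "R P = {(u, v). u \<in> C \<and> v \<in> C \<and> (u = v \<or> v \<in> nbr G u \<and> P (tri u v))}" for P
  have tri_sym: "tri u v = tri v u" for u v
    using sym by (auto simp: tri_def)
  have refl_sym: "refl_on C (R P)" "sym (R P)" "R P \<subseteq> C \<times> C" for P
    using tri_sym sym by (auto simp: R_def refl_on_def sym_def)
  \<comment> \<open>If the neighbours \<open>u\<close> and \<open>w\<close> of \<open>v\<close> are
    not adjacent, only the third neighbour \<open>z\<close> can complete both triangles, and then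
    \<open>u\<close>, \<open>v\<close>, \<open>z\<close>, \<open>w\<close> induce a diamond.\<close>
  have tri_trans: "w \<in> nbr G u \<and> tri u w"
    if v: "v \<in> C" and "tri u v" "tri v w" and uw: "u \<noteq> w" for u v w
  proof -
    have vw: "u \<in> nbr G v" "w \<in> nbr G v"
      using that sym by (auto simp: tri_def)
    then obtain z where z: "nbr G v = {u, w, z}" "z \<noteq> u" "z \<noteq> w"
      using third_nbr[OF G] v C uw by blast
    have "w \<in> nbr G u"
    proof (rule ccontr)
      assume nadj: "w \<notin> nbr G u"
      then have "u \<notin> nbr G w" using sym by blast
      have "nbr G u \<inter> {u, w, z} \<noteq> {}" "{u, w, z} \<inter> nbr G w \<noteq> {}"
        using \<open>tri u v\<close> \<open>tri v w\<close> z by (simp_all add: tri_def)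
      then have "z \<in> nbr G u" "z \<in> nbr G w"
        using nadj \<open>u \<notin> nbr G w\<close> irrefl by auto
      then have "embeds G diamond [u, v, z, w]"
        using nadj uw z vw sym by (intro embeds_diamondI[OF G']) auto
      from no_diamond[OF this] v show False by auto
    qed
    then show ?thesis using vw sym by (auto simp: tri_def)
  qed
  \<comment> \<open>The hypotheses are contradictory: two edges at \<open>v\<close> outside all
    triangles leave the three neighbours of \<open>v\<close> pairwise nonadjacent, which is a claw.
    Edges in no triangle thus form a matching.\<close>
  have nontri_trans: "w \<in> nbr G u \<and> \<not> tri u w"
    if v: "v \<in> C" and "v \<in> nbr G u" "\<not> tri u v" "w \<in> nbr G v" "\<not> tri v w" and uw: "u \<noteq> w" for u v w
  proof -
    have vw: "u \<in> nbr G v" "w \<in> nbr G v"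
      using that sym by auto
    then obtain z where z: "nbr G v = {u, w, z}" "z \<noteq> u" "z \<noteq> w"
      using third_nbr[OF G] v C uw by blast
    have "nbr G u \<inter> nbr G v = {}" "nbr G v \<inter> nbr G w = {}"
      using that unfolding tri_def by auto
    then have "embeds G claw [v, u, w, z]"
      using z uw sym by (intro embeds_clawI[OF G']) auto
    from no_claw[OF this] v show ?thesis by auto
  qed
  have "trans (R (\<lambda>t. t))"
  proof (rule transI)
    fix u v w assume "(u, v) \<in> R (\<lambda>t. t)" "(v, w) \<in> R (\<lambda>t. t)"
    then show "(u, w) \<in> R (\<lambda>t. t)"
      using tri_trans[of v u w] by (cases "u = w"; cases "u = v"; cases "v = w") (simp_all add: R_def)
  qed
  then have "equiv C (R (\<lambda>t. t))"
    using refl_sym by (simp add: equiv_def)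
  moreover have "trans (R Not)"
  proof (rule transI)
    fix u v w assume "(u, v) \<in> R Not" "(v, w) \<in> R Not"
    then show "(u, w) \<in> R Not"
      using nontri_trans[of v u w] by (cases "u = w"; cases "u = v"; cases "v = w") (simp_all add: R_def)
  qed
  then have "equiv C (R Not)"
    using refl_sym by (simp add: equiv_def)
  ultimately have "0 \<le> (\<Sum>v\<in>C. x v * (\<Sum>u\<in>R (\<lambda>t. t) `` {v}. x u)) + (\<Sum>v\<in>C. x v * (\<Sum>u\<in>R Not `` {v}. x u))"
    using equiv_form_nonneg[OF finC] by (intro add_nonneg_nonneg) auto
  also have "\<dots> = (\<Sum>v\<in>C. x v * ((\<Sum>u\<in>nbr G v. x u) + 2 * x v))"
    unfolding sum.distrib[symmetric]
  proof (rule sum.cong[OF refl])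
    fix v assume v: "v \<in> C"
    have R: "R P `` {v} = insert v {u \<in> nbr G v. P (tri v u)}" for P
      using v closed[OF v] by (auto simp: R_def)
    have fin: "finite {u \<in> nbr G v. P u}" for P
      using finite_nbr[OF G'] by simp
    have "(\<Sum>u\<in>nbr G v. x u) = (\<Sum>u | u \<in> nbr G v \<and> tri v u. x u) + (\<Sum>u | u \<in> nbr G v \<and> \<not> tri v u. x u)"
      using fin by (subst sum.union_disjoint[symmetric]) (auto intro!: sum.cong)
    then show "x v * (\<Sum>u\<in>R (\<lambda>t. t) `` {v}. x u) + x v * (\<Sum>u\<in>R Not `` {v}. x u)
        = x v * ((\<Sum>u\<in>nbr G v. x u) + 2 * x v)"
      unfolding R using fin irrefl by (simp add: algebra_simps)
  qed
  also have "\<dots> = (\<Sum>v\<in>C. x v * (\<Sum>u\<in>nbr G v. x u)) + 2 * (\<Sum>v\<in>C. (x v)\<^sup>2)"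
    by (simp add: algebra_simps sum.distrib sum_distrib_left power2_eq_square)
  finally show ?thesis by simp
qed

section \<open>Certificates for an exhaustive search\<close>

text \<open>The sublists with at most \<open>k\<close> entries. Their order is the order in which
  the children of a \<open>Grow\<close> node have to be listed.\<close>

fun picks :: "nat \<Rightarrow> 'b list \<Rightarrow> 'b list list" where
  "picks 0 xs = [[]]"
| "picks (Suc k) [] = [[]]"
| "picks (Suc k) (x # xs) = map ((#) x) (picks k xs) @ picks (Suc k) xs"

lemma filter_in_picks: "length (filter P xs) \<le> k \<Longrightarrow> filter P xs \<in> set (picks k xs)"
  by (induction k xs rule: picks.induct) (auto split: if_splits)

text \<open>The possible neighbourhoods, within an induced copy of \<open>H\<close>, of a further neighbour of the
  vertex \<open>v\<close>: in a cubic graph it can only meet vertices of degree less than 3 in \<open>H\<close>.\<close>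

definition choices :: "nat list list \<Rightarrow> nat \<Rightarrow> nat list list" where
  "choices H v = filter (\<lambda>T. v \<in> set T) (picks 3 (filter (\<lambda>i. length (H ! i) < 3) [0..<length H]))"

text \<open>The new vertex gets the number \<open>length H\<close>, so old numbers stay valid and a
  copy is extended by appending one vertex to its list.\<close>

definition attach :: "nat list list \<Rightarrow> nat list \<Rightarrow> nat list list" where
  "attach H T = map (\<lambda>i. if i \<in> set T then H ! i @ [length H] else H ! i) [0..<length H] @ [T]"

text \<open>The quadratic form of the adjacency matrix. The type of the entries is left open because
  certificates are evaluated over the integers while eigenvectors are real.\<close>

definition list_form :: "nat list list \<Rightarrow> 'b::comm_ring_1 list \<Rightarrow> 'b" where
  "list_form H x = (\<Sum>i\<leftarrow>[0..<length H]. x ! i * (\<Sum>j\<leftarrow>H ! i. x ! j))"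

definition sqnorm :: "'b::comm_ring_1 list \<Rightarrow> 'b" where
  "sqnorm x = (\<Sum>t\<leftarrow>x. t * t)"

text \<open>An executable test: vertex \<open>i\<close> of \<open>K\<close> is vertex
  \<open>p ! i\<close> of \<open>H\<close>. Rows are compared as sets because growing need not
  produce neighbours in the order listed in \<open>K\<close>.\<close>

definition relabels :: "nat list \<Rightarrow> nat list list \<Rightarrow> nat list list \<Rightarrow> bool" where
  "relabels p H K \<longleftrightarrow> length H = length K \<and> length p = length K \<and> distinct p \<and>
     (\<forall>i\<in>set p. i < length K) \<and>
     (\<forall>i\<in>set [0..<length K]. distinct (K ! i) \<and> (\<forall>j\<in>set (K ! i). j < length K) \<and>
        set (H ! (p ! i)) = set (map ((!) p) (K ! i)))"

text \<open>A leaf \<open>Vec x\<close> refutes a graph by a test vector, \<open>Grow v\<close> branches over all ways of adding a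
  missing neighbour of \<open>v\<close>, and \<open>Known k p\<close> recognises the \<open>k\<close>-th listed graph through the
  relabelling \<open>p\<close>. The number \<open>- 2.0392\<close> is a rational lower bound of \<open>beta\<close>, close enough for
  every refutation that occurs.\<close>

datatype cert = Vec "int list" | Grow nat "cert list" | Known nat "nat list"

fun check :: "nat list list list \<Rightarrow> nat list list \<Rightarrow> cert \<Rightarrow> bool" where
  "check Ks H (Vec x) \<longleftrightarrow>
     length x = length H \<and> 10000 * list_form H x < - 20392 * sqnorm x"
| "check Ks H (Grow v cs) \<longleftrightarrow>
     v < length H \<and> length (H ! v) < 3 \<and> list_all2 (\<lambda>T. check Ks (attach H T)) (choices H v) cs"
| "check Ks H (Known k p) \<longleftrightarrow> k < length Ks \<and> relabels p H (Ks ! k)"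

section \<open>Soundness of the certificates\<close>

lemma embeds_sum_nbr:
  assumes e: "embeds G H vs" and i: "i < length H"
  shows "(\<Sum>u\<in>nbr G (vs ! i) \<inter> set vs. f u) = (\<Sum>j\<leftarrow>H ! i. f (vs ! j))"
proof -
  have "inj_on ((!) vs) (set (H ! i))"
    using e i by (intro inj_on_nth) (auto simp: embeds_def)
  then show ?thesis
    using e i by (auto simp: embeds_def sum.reindex sum_list_distinct_conv_sum_set)
qed

text \<open>\<open>y\<close> is \<open>x\<close> extended by zero, so all terms with an endpoint
  outside the copy vanish. This is the form in which interlacing enters.\<close>

lemma embeds_form:
  fixes x :: "'b::comm_ring_1 list"
  assumes G: "pair_graph G" and e: "embeds G H vs" and x: "length x = length H"
  obtains y :: "'a \<Rightarrow> 'b" where "\<And>i. i < length H \<Longrightarrow> y (vs ! i) = x ! i" "\<And>v. v \<notin> set vs \<Longrightarrow> y v = 0"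
    "(\<Sum>v\<in>pverts G. y v * (\<Sum>u\<in>nbr G v. y u)) = list_form H x"
    "(\<Sum>v\<in>pverts G. y v * y v) = sqnorm x"
proof
  note e' = e[unfolded embeds_def]
  define y where "y v = (if v \<in> set vs then x ! the_inv_into {..<length vs} ((!) vs) v else 0)" for v
  show y: "y (vs ! i) = x ! i" if "i < length H" for i
    using that e' by (simp add: y_def the_inv_into_f_f inj_on_nth)
  show y0: "y v = 0" if "v \<notin> set vs" for v
    using that by (simp add: y_def)
  have fin: "finite (pverts G)" by (rule finite_pverts[OF G])
  have bij: "bij_betw ((!) vs) {0..<length H} (set vs)"
    using e' by (intro bij_betw_nth) auto
  have "(\<Sum>v\<in>pverts G. y v * (\<Sum>u\<in>nbr G v. y u)) = (\<Sum>v\<in>set vs. y v * (\<Sum>u\<in>nbr G v. y u))"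
    using fin e' y0 by (intro sum.mono_neutral_right) auto
  also have "\<dots> = (\<Sum>v\<in>set vs. y v * (\<Sum>u\<in>nbr G v \<inter> set vs. y u))"
    using finite_nbr[OF G] y0
    by (intro sum.cong refl arg_cong2[where f = "(*)"] sum.mono_neutral_right) auto
  also have "\<dots> = (\<Sum>i=0..<length H. y (vs ! i) * (\<Sum>u\<in>nbr G (vs ! i) \<inter> set vs. y u))"
    by (rule sum.reindex_bij_betw[OF bij, symmetric])
  also have "\<dots> = (\<Sum>i=0..<length H. x ! i * (\<Sum>j\<leftarrow>H ! i. x ! j))"
  proof (intro sum.cong refl)
    fix i assume "i \<in> {0..<length H}"
    then have i: "i < length H" by simp
    have "map (\<lambda>j. y (vs ! j)) (H ! i) = map ((!) x) (H ! i)"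
      using e' i y by (auto intro!: map_cong)
    then show "y (vs ! i) * (\<Sum>u\<in>nbr G (vs ! i) \<inter> set vs. y u) = x ! i * (\<Sum>j\<leftarrow>H ! i. x ! j)"
      unfolding embeds_sum_nbr[OF e i] y[OF i] by (rule arg_cong)
  qed
  finally show "(\<Sum>v\<in>pverts G. y v * (\<Sum>u\<in>nbr G v. y u)) = list_form H x"
    by (simp add: list_form_def interv_sum_list_conv_sum_set_nat)
  have "(\<Sum>v\<in>pverts G. y v * y v) = (\<Sum>v\<in>set vs. y v * y v)"
    using fin e' y0 by (intro sum.mono_neutral_right) auto
  also have "\<dots> = (\<Sum>i=0..<length H. y (vs ! i) * y (vs ! i))"
    by (rule sum.reindex_bij_betw[OF bij, symmetric])
  also have "\<dots> = sqnorm x"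
    using x y by (simp add: sqnorm_def sum_list_sum_nth)
  finally show "(\<Sum>v\<in>pverts G. y v * y v) = sqnorm x" .
qed

text \<open>Row \<open>v\<close> is too short for a vertex of degree 3, so some neighbour
  \<open>w\<close> of it lies outside the copy. The set \<open>T\<close> of neighbours of
  \<open>w\<close> inside is among the choices: it has at most 3 elements, contains
  \<open>v\<close>, and each of its vertices has the neighbour \<open>w\<close> outside the copy,
  hence degree less than 3 in \<open>H\<close>.\<close>

lemma embeds_attach:
  assumes G: "regular_graph 3 G" and e: "embeds G H vs" and v: "v < length H" "length (H ! v) < 3"
  obtains w T where "T \<in> set (choices H v)" "embeds G (attach H T) (vs @ [w])"
proof -
  note G' = regular_graphD(1)[OF G]
  note e' = e[unfolded embeds_def]
  have card_row: "card (nbr G (vs ! i) \<inter> set vs) = length (H ! i)" if "i < length H" for i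
    using embeds_sum_nbr[OF e that, of "\<lambda>_. 1 :: nat"] by (simp add: sum_list_triv)
  have in_verts: "vs ! i \<in> pverts G" if "i < length H" for i
    using e' that nth_mem[of i vs] by auto
  have "\<not> nbr G (vs ! v) \<subseteq> set vs"
    using card_row[OF v(1)] v(2) regular_graphD(3)[OF G in_verts[OF v(1)]] by (auto simp: Int_absorb2)
  then obtain w where w: "w \<in> nbr G (vs ! v)" "w \<notin> set vs" by blast
  define T where "T = filter (\<lambda>i. vs ! i \<in> nbr G w) [0..<length H]"
  have w_vert: "w \<in> pverts G" using w nbr_subset[OF G'] by blast
  have T_less: "length (H ! i) < 3" if "i \<in> set T" for i
  proof -
    have i: "i < length H" "w \<in> nbr G (vs ! i)"
      using that nbr_sym[OF G'] by (auto simp: T_def)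
    then have "nbr G (vs ! i) \<inter> set vs \<subset> nbr G (vs ! i)" using w by blast
    from psubset_card_mono[OF finite_nbr[OF G'] this]
    show ?thesis using card_row regular_graphD(3)[OF G in_verts] i by simp
  qed
  have image_T: "(!) vs ` set T = nbr G w \<inter> set vs"
    using e' by (auto simp: T_def in_set_conv_nth)
  have "length T = card (set T)"
    by (rule distinct_card[symmetric]) (simp add: T_def)
  also have "\<dots> = card ((!) vs ` set T)"
    using e' by (intro card_image[symmetric] inj_on_nth) (auto simp: T_def)
  also have "\<dots> \<le> card (nbr G w)"
    unfolding image_T by (intro card_mono finite_nbr[OF G']) auto
  finally have "length T \<le> 3"
    using regular_graphD(3)[OF G w_vert] by simp
  moreover have T: "T = filter (\<lambda>i. vs ! i \<in> nbr G w) (filter (\<lambda>i. length (H ! i) < 3) [0..<length H])"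
    using T_less unfolding T_def filter_filter by (intro filter_cong) auto
  ultimately have "T \<in> set (picks 3 (filter (\<lambda>i. length (H ! i) < 3) [0..<length H]))"
    unfolding T by (intro filter_in_picks)
  moreover have "v \<in> set T"
    using w v nbr_sym[OF G'] by (auto simp: T_def)
  ultimately have "T \<in> set (choices H v)"
    by (simp add: choices_def)
  moreover have "embeds G (attach H T) (vs @ [w])"
  proof -
    have vs: "length vs = length H" "distinct vs" "set vs \<subseteq> pverts G"
      using e' by auto
    have T_set: "set T \<subseteq> {..<length H}" "distinct T" by (auto simp: T_def)
    have H: "distinct (H ! i)" "set (H ! i) \<subseteq> {..<length H}" "nbr G (vs ! i) \<inter> set vs = (!) vs ` set (H ! i)"
      if "i < length H" for i
      using e' that by auto
    have row: "attach H T ! i = (if i \<in> set T then H ! i @ [length H] else H ! i)" if "i < length H" for i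
      using that by (simp add: attach_def nth_append)
    have row_n: "attach H T ! length H = T"
      by (simp add: attach_def nth_append)
    have len: "length (attach H T) = Suc (length H)"
      by (simp add: attach_def)
    have app: "(vs @ [w]) ! j = vs ! j" if "j < length H" for j
      using that vs(1) by (simp add: nth_append)
    have app_n: "(vs @ [w]) ! length H = w"
      using vs(1) by (metis nth_append_length)
    have img: "(!) (vs @ [w]) ` S = (!) vs ` S" if "S \<subseteq> {..<length H}" for S
      using that app by (intro image_cong) auto
    have "distinct (attach H T ! i) \<and> set (attach H T ! i) \<subseteq> {..<Suc (length H)} \<and>
        nbr G ((vs @ [w]) ! i) \<inter> set (vs @ [w]) = (!) (vs @ [w]) ` set (attach H T ! i)"
      if "i < Suc (length H)" for i
    proof (cases "i = length H")
      case True
      then show ?thesis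
        using T_set img[OF T_set(1)] image_T nbr_irrefl[OF G', of w]
        by (auto simp: row_n app_n)
    next
      case False
      then have i: "i < length H" using that by simp
      have wi: "w \<in> nbr G (vs ! i) \<longleftrightarrow> i \<in> set T"
        using i nbr_sym[OF G'] by (auto simp: T_def)
      have "nbr G (vs ! i) \<inter> set (vs @ [w]) = (!) vs ` set (H ! i) \<union> (if i \<in> set T then {w} else {})"
        using H(3)[OF i] wi by auto
      also have "\<dots> = (!) (vs @ [w]) ` set (attach H T ! i)"
        using img[OF H(2)[OF i]] app_n by (simp add: row[OF i])
      finally show ?thesis
        using H(1,2)[OF i] by (auto simp: row[OF i] app[OF i])
    qed
    then show ?thesis
      using vs w(2) w_vert by (simp add: embeds_def len)
  qed
  ultimately show thesis by (rule that)
qed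

lemma embeds_relabel:
  assumes e: "embeds G H vs" and r: "relabels p H K"
  shows "embeds G K (map ((!) vs) p)" "set (map ((!) vs) p) = set vs"
proof -
  have vs: "length vs = length K" "distinct vs" "set vs \<subseteq> pverts G"
    and p: "length p = length K" "distinct p" "\<And>i. i \<in> set p \<Longrightarrow> i < length K"
    and len: "length H = length K"
    using e r by (auto simp: embeds_def relabels_def)
  have row: "nbr G (vs ! i) \<inter> set vs = (!) vs ` set (H ! i)" if "i < length K" for i
    using e that len by (simp add: embeds_def)
  have K: "distinct (K ! i)" "\<And>j. j \<in> set (K ! i) \<Longrightarrow> j < length K"
    "set (H ! (p ! i)) = (!) p ` set (K ! i)" if "i < length K" for i
    using r that by (auto simp: relabels_def)
  have "card (set p) = length K" "set p \<subseteq> {..<length K}"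
    using p distinct_card[of p] by auto
  then have "set p = {0..<length K}"
    unfolding lessThan_atLeast0 by (intro card_subset_eq) auto
  then show sets: "set (map ((!) vs) p) = set vs"
    using vs(1) nth_image[of "length K" vs] by simp
  have inj: "inj_on ((!) vs) (set p)"
    using vs p(3) by (intro inj_on_nth) auto
  show "embeds G K (map ((!) vs) p)"
    unfolding embeds_def
  proof (intro conjI allI impI)
    fix i assume i: "i < length K"
    show "distinct (K ! i)" "set (K ! i) \<subseteq> {..<length K}" using K[OF i] by auto
    have pi: "p ! i < length K" using p(1,3) i by simp
    have "nbr G (map ((!) vs) p ! i) \<inter> set (map ((!) vs) p) = (!) vs ` (!) p ` set (K ! i)"
      unfolding sets K(3)[OF i, symmetric] row[OF pi, symmetric] using p(1) i by simp
    also have "\<dots> = (!) (map ((!) vs) p) ` set (K ! i)"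
      unfolding image_image using K(2)[OF i] p(1) by (intro image_cong) auto
    finally show "nbr G (map ((!) vs) p ! i) \<inter> set (map ((!) vs) p) = (!) (map ((!) vs) p) ` set (K ! i)" .
  next
    show "length (map ((!) vs) p) = length K" using p(1) by simp
    show "distinct (map ((!) vs) p)" using inj p(2) by (simp add: distinct_map)
    show "set (map ((!) vs) p) \<subseteq> pverts G" unfolding sets by (rule vs(3))
  qed
qed

lemma of_int_sum_list: "of_int (sum_list xs) = (\<Sum>x\<leftarrow>xs. of_int x)"
  by (induction xs) simp_all

text \<open>The inclusion of \<open>vs\<close> in \<open>ws\<close> ties the graph recognised at a
  leaf to the claw or diamond at the root. It survives every step because growing only appends
  vertices and relabelling only permutes them.\<close>

lemma check_sound:
  assumes G: "regular_graph 3 G" and ev: "- 20392 / 10000 \<le> smallest_eigenvalue G"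
  shows "check Ks H c \<Longrightarrow> embeds G H vs \<Longrightarrow> \<exists>K\<in>set Ks. \<exists>ws. embeds G K ws \<and> set vs \<subseteq> set ws"
proof (induction Ks H c arbitrary: vs rule: check.induct)
  case (1 Ks H x)
  note G' = regular_graphD(1,2)[OF G]
  have "length (map real_of_int x) = length H" using 1 by simp
  then obtain y where y: "adj_form G y = list_form H (map real_of_int x)"
    "(\<Sum>v\<in>pverts G. (y v)\<^sup>2) = sqnorm (map real_of_int x)"
    using embeds_form[OF G'(1) 1(2)] unfolding adj_form_def power2_eq_square by metis
  have "list_form H (map real_of_int x) = real_of_int (list_form H x)"
  proof -
    have "map real_of_int x ! i = real_of_int (x ! i)" if "i < length H" for i
      using that 1 by simp
    then show ?thesis
      unfolding list_form_def of_int_sum_list map_map comp_def of_int_mult using 1(2)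
      by (intro arg_cong[where f = sum_list] map_cong arg_cong2[where f = "(*)"])
        (auto simp: embeds_def subset_iff)
  qed
  moreover have "sqnorm (map real_of_int x) = real_of_int (sqnorm x)"
    by (simp add: sqnorm_def of_int_sum_list comp_def)
  moreover have "real_of_int (10000 * list_form H x) < real_of_int (- 20392 * sqnorm x)"
    using 1(1) unfolding of_int_less_iff by simp
  ultimately have lt: "10000 * adj_form G y < - 20392 * (\<Sum>v\<in>pverts G. (y v)\<^sup>2)"
    using y by simp
  have "- 20392 / 10000 * (\<Sum>v\<in>pverts G. (y v)\<^sup>2) \<le> smallest_eigenvalue G * (\<Sum>v\<in>pverts G. (y v)\<^sup>2)"
    using ev by (intro mult_right_mono sum_nonneg) auto
  then have False
    using lt smallest_eigenvalue_rayleigh[OF G', of y] by simp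
  then show ?case ..
next
  case (2 Ks H v cs)
  then obtain w T where T: "T \<in> set (choices H v)" "embeds G (attach H T) (vs @ [w])"
    using embeds_attach[OF G 2(3), of v] by (metis check.simps(2))
  from T(1) obtain i where i: "i < length (choices H v)" "choices H v ! i = T"
    unfolding in_set_conv_nth by blast
  moreover have "list_all2 (\<lambda>T. check Ks (attach H T)) (choices H v) cs"
    using 2(2) by simp
  ultimately obtain c where "c \<in> set cs" "check Ks (attach H T) c"
    unfolding list_all2_conv_all_nth by (metis nth_mem)
  then show ?case
    using 2(1)[OF T(1)] T(2) by fastforce
next
  case (3 Ks H k p)
  then show ?case
    using embeds_relabel[OF 3(2), of p "Ks ! k"] by (metis check.simps(3) nth_mem order_refl)
qed

section \<open>The search from the claw and the diamond\<close>

text \<open>The edge between 6 and 7 is a bridge. On one side the diamond 0, 1, 2, 3 is joined by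
  two edges to the triangle 4, 5, 6; the other side is built on the three triangles 7, 8, 9 and 10,
  12, 13 and 11, 14, 15. Every vertex lies in a triangle, so there is no induced claw and only the
  search from the diamond meets this graph.\<close>

definition extremal :: "nat list list" where
  "extremal = [[1,2,4],[0,2,3],[0,1,3],[1,2,5],[0,5,6],[3,4,6],[4,5,7],[6,8,9],
     [7,9,10],[7,8,11],[8,12,13],[9,14,15],[10,13,15],[10,12,14],[11,13,15],[11,12,14]]"

text \<open>The cubic graphs with smallest eigenvalue at least \<open>- 2\<close> that the search from a claw or a
  diamond runs into.\<close>

definition order_ten :: "nat list list list" where
  "order_ten = [
     [[1,2,3],[0,4,5],[0,6,7],[0,8,9],[1,5,6],[1,4,6],[2,4,5],[2,8,9],[3,7,9],[3,7,8]],
     [[1,2,3],[0,4,5],[0,6,7],[0,8,9],[1,5,6],[1,4,7],[2,4,8],[2,5,9],[3,6,9],[3,7,8]],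
     [[1,2,3],[0,4,5],[0,6,7],[0,8,9],[1,5,6],[1,4,8],[2,4,7],[2,6,9],[3,5,9],[3,7,8]],
     [[1,2,3],[0,4,5],[0,6,7],[0,8,9],[1,6,8],[1,7,9],[2,4,9],[2,5,8],[3,4,7],[3,5,6]],
     [[1,2,4],[0,2,3],[0,1,3],[1,2,5],[0,6,7],[3,8,9],[4,7,8],[4,6,9],[5,6,9],[5,7,8]]]"

text \<open>In \<open>Known k\<close>, the number 0 means \<open>extremal\<close> and a positive
  \<open>k\<close> means entry \<open>k - 1\<close> of \<open>order_ten\<close>. The four branches
  at the root are the ways to attach a new neighbour of leaf 1 to the leaves of the claw; the first
  gives K_{2,3}, where the vector has form - 12 and squared norm 5.\<close>

definition claw_cert :: cert where
  "claw_cert =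
     Grow 1 [Vec [-1,1,1,1,-1], Vec [-2,2,2,1,-2], Vec [-2,2,1,2,-2],
     Grow 1 [Vec [2,-2,0,-2,1,2], Vec [-2,2,2,1,0,-2], Vec [2,-2,-2,0,1,2], Vec [-2,2,1,2,0,-2],
     Vec [2,-2,0,-2,1,2], Grow 4 [Vec [-2,0,2,2,1,0,-2], Grow 2 [Vec [2,0,-2,-2,0,0,1,2],
     Grow 3 [Grow 3 [Known 1 [0,1,2,3,4,5,6,7,8,9], Vec [0,0,1,-2,0,0,0,-2,2,2],
     Vec [6,-3,-6,-4,0,0,3,3,0,2], Vec [11,-10,0,-12,5,5,-5,-4,8,6]],
     Vec [6,-3,-6,-4,0,0,3,3,2]]], Grow 2 [Vec [2,0,-2,-2,0,0,1,2], Vec [-2,1,2,2,0,0,0,-2],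
     Vec [2,0,-2,-2,0,0,1,2], Grow 3 [Grow 3 [Grow 8 [Vec [-6,3,4,6,0,0,0,-2,-3,-3,3],
     Vec [-9,6,6,7,0,-3,-3,0,-3,-2,2]], Vec [6,-3,-4,-6,0,0,0,2,3,3]]],
     Grow 6 [Vec [0,0,2,0,0,1,-2,-2,2], Grow 3 [Known 2 [0,1,2,3,4,5,6,7,8,9],
     Vec [0,0,2,-2,0,1,-2,-3,2,2], Vec [3,0,-6,0,-3,0,6,3,-4,2], Vec [-2,2,0,3,-2,0,2,0,-2,-1]],
     Vec [0,0,2,0,0,1,-2,-2,2], Vec [-4,0,6,2,3,0,-6,-3,3]],
     Grow 5 [Grow 3 [Vec [3,0,0,-6,0,-3,2,-4,6,3]], Grow 3 [Known 3 [0,1,2,3,4,5,6,7,8,9],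
     Vec [6,-3,-4,-6,0,0,2,0,3,3], Grow 7 [Vec [-3,1,2,2,0,0,0,-2,0,-2,2],
     Vec [-9,6,7,6,0,-3,-2,-3,0,-3,2]], Vec [6,-3,-4,-6,0,0,0,2,3,3]],
     Vec [-3,2,2,1,0,-2,0,-2,2], Grow 7 [Vec [0,0,0,-1,-2,2,2,-2,-2,3],
     Grow 3 [Vec [3,-2,-1,-2,0,2,0,0,-2,0,2], Vec [-1,0,0,3,2,-2,-2,2,2,-2,-2],
     Vec [-4,3,3,3,0,-2,-1,0,1,-1,-1], Vec [6,-3,-4,-6,0,0,2,0,0,3,3]],
     Grow 8 [Vec [-3,1,2,2,0,0,0,-2,0,2,-2], Vec [0,0,0,0,2,-2,-2,2,3,-2,-1],
     Grow 10 [Vec [-11,7,7,8,0,-3,-3,0,0,-2,4,-6], Grow 3 [Vec [3,-1,-2,-2,0,0,0,2,0,-2,2,-2,2],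
     Vec [-11,7,8,7,0,-3,0,-6,0,4,-2,0,-3]]], Vec [0,0,0,0,2,-2,-2,2,3,-2,-1]],
     Grow 3 [Vec [2,0,-2,-2,0,0,0,2,-1,-2,3], Vec [-3,2,1,2,0,-2,0,0,2,0,-2],
     Vec [3,-1,-2,-2,0,0,0,2,0,-2,2], Vec [-7,5,5,4,0,-3,0,-3,2,2,-2]]]],
     Vec [6,-4,-6,-3,0,2,3,3]], Grow 3 [Vec [2,0,-2,-2,0,0,1,2],
     Grow 2 [Grow 2 [Known 1 [0,1,3,2,4,5,6,7,8,9], Vec [0,0,-2,1,0,0,0,-2,2,2],
     Vec [6,-3,-4,-6,0,0,3,3,0,2], Vec [11,-10,-12,0,5,5,-5,-4,8,6]],
     Vec [6,-3,-4,-6,0,0,3,3,2]]], Grow 3 [Vec [2,0,-2,-2,0,0,1,2], Vec [-2,1,2,2,0,0,0,-2],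
     Vec [2,0,-2,-2,0,0,1,2], Grow 2 [Grow 2 [Grow 8 [Vec [-6,3,6,4,0,0,0,-2,-3,-3,3],
     Vec [-9,6,7,6,0,-3,-3,0,-3,-2,2]], Vec [6,-3,-6,-4,0,0,0,2,3,3]]],
     Grow 6 [Vec [0,0,0,2,0,1,-2,-2,2], Grow 2 [Known 2 [0,1,3,2,4,5,6,7,8,9],
     Vec [0,0,2,-2,0,-1,2,3,-2,-2], Vec [3,0,0,-6,-3,0,6,3,-4,2], Vec [2,-2,-3,0,2,0,-2,0,2,1]],
     Vec [0,0,0,2,0,1,-2,-2,2], Vec [-4,0,2,6,3,0,-6,-3,3]],
     Grow 5 [Grow 2 [Vec [3,0,-6,0,0,-3,2,-4,6,3]], Grow 2 [Known 3 [0,1,2,3,5,4,8,9,6,7],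
     Vec [6,-3,-6,-4,0,0,2,0,3,3], Grow 7 [Vec [-3,1,2,2,0,0,0,-2,0,-2,2],
     Vec [-9,6,6,7,0,-3,-2,-3,0,-3,2]], Vec [6,-3,-6,-4,0,0,0,2,3,3]],
     Vec [-3,2,1,2,0,-2,0,-2,2], Grow 7 [Vec [0,0,1,0,2,-2,-2,2,2,-3],
     Grow 2 [Vec [3,-2,-2,-1,0,2,0,0,-2,0,2], Vec [-1,0,3,0,2,-2,-2,2,2,-2,-2],
     Vec [-4,3,3,3,0,-2,-1,0,1,-1,-1], Vec [6,-3,-6,-4,0,0,2,0,0,3,3]],
     Grow 8 [Vec [3,-1,-2,-2,0,0,0,2,0,-2,2], Vec [0,0,0,0,2,-2,-2,2,3,-2,-1],
     Grow 10 [Vec [-11,7,8,7,0,-3,-3,0,0,-2,4,-6], Grow 2 [Vec [3,-1,-2,-2,0,0,0,2,0,-2,2,-2,2],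
     Vec [-11,7,7,8,0,-3,0,-6,0,4,-2,0,-3]]], Vec [0,0,0,0,2,-2,-2,2,3,-2,-1]],
     Grow 2 [Vec [-2,0,2,2,0,0,0,-2,1,2,-3], Vec [3,-2,-2,-1,0,2,0,0,-2,0,2],
     Vec [-3,1,2,2,0,0,0,-2,0,2,-2], Vec [-7,5,4,5,0,-3,0,-3,2,2,-2]]]],
     Vec [6,-4,-3,-6,0,2,3,3]], Grow 6 [Vec [-2,0,2,2,0,0,1,-2], Vec [2,-2,-2,0,1,1,-2,2],
     Vec [-2,2,0,2,-1,-1,2,-2], Vec [-5,5,2,2,-3,-3,4,-2]], Grow 5 [Vec [-2,0,2,2,0,1,0,-2],
     Vec [0,0,1,0,-2,2,2,-2], Grow 2 [Vec [0,0,2,1,-2,2,2,-2,-3], Vec [-2,1,2,2,0,0,0,0,-2],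
     Vec [2,0,-2,-2,0,0,0,1,2], Vec [3,-2,-2,-1,2,0,-2,0,2], Vec [1,0,-3,0,2,-2,-2,2,2],
     Grow 8 [Vec [0,0,0,-1,2,-2,-2,2,-2,3], Grow 3 [Vec [3,-2,-1,-2,2,0,-2,0,0,0,2],
     Vec [1,0,0,-3,2,-2,-2,2,-2,2,2], Vec [-4,3,3,3,-2,0,1,-1,0,-1,-1],
     Vec [6,-3,-4,-6,0,0,0,2,0,3,3]], Grow 6 [Vec [-3,1,2,2,0,0,0,0,-2,2,-2],
     Vec [0,0,0,0,-2,2,3,-2,2,-2,-1], Grow 10 [Vec [-11,7,7,8,0,-3,-2,0,-3,0,4,-6],
     Grow 3 [Vec [-3,1,2,2,0,0,0,0,-2,2,-2,2,-2], Vec [-11,7,8,7,0,-3,0,0,-6,4,-2,0,-3]]],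
     Vec [0,0,0,0,2,-2,-3,2,-2,2,1]], Grow 3 [Vec [2,0,-2,-2,0,0,-1,0,2,-2,3],
     Vec [-7,4,5,5,0,-2,2,0,-3,2,-3], Vec [3,-1,-2,-2,0,0,0,0,2,-2,2],
     Vec [-9,6,7,6,-3,0,0,-2,-3,2,-3]]], Vec [6,-4,-6,-3,2,0,0,3,3]], Vec [0,0,0,1,-2,2,2,-2],
     Grow 3 [Vec [0,0,1,2,-2,2,2,-2,-3], Vec [-2,1,2,2,0,0,0,0,-2], Vec [2,0,-2,-2,0,0,0,1,2],
     Vec [3,-2,-1,-2,2,0,-2,0,2], Vec [1,0,0,-3,2,-2,-2,2,2],
     Grow 8 [Vec [0,0,-1,0,2,-2,-2,2,-2,3], Grow 2 [Vec [-3,2,2,1,-2,0,2,0,0,0,-2],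
     Vec [1,0,-3,0,2,-2,-2,2,-2,2,2], Vec [-4,3,3,3,-2,0,1,-1,0,-1,-1],
     Vec [6,-3,-6,-4,0,0,0,2,0,3,3]], Grow 6 [Vec [3,-1,-2,-2,0,0,0,0,2,-2,2],
     Vec [0,0,0,0,2,-2,-3,2,-2,2,1], Grow 10 [Vec [-11,7,8,7,0,-3,-2,0,-3,0,4,-6],
     Grow 2 [Vec [-3,1,2,2,0,0,0,0,-2,2,-2,2,-2], Vec [-11,7,7,8,0,-3,0,0,-6,4,-2,0,-3]]],
     Vec [0,0,0,0,-2,2,3,-2,2,-2,-1]], Grow 2 [Vec [2,0,-2,-2,0,0,-1,0,2,-2,3],
     Vec [-7,4,5,5,0,-2,2,0,-3,2,-3], Vec [-3,1,2,2,0,0,0,0,-2,2,-2],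
     Vec [-9,6,6,7,-3,0,0,-2,-3,2,-3]]], Vec [6,-4,-3,-6,2,0,0,3,3]],
     Grow 6 [Vec [0,0,0,0,2,-2,-2,2,1], Vec [3,-2,-2,-1,0,2,0,-2,2], Vec [0,0,0,0,2,-2,-2,2,1],
     Vec [3,-2,-1,-2,0,2,0,-2,2], Vec [0,0,0,0,2,-2,-2,2,1], Grow 8 [Vec [-2,0,2,2,0,0,0,0,1,-2],
     Grow 2 [Vec [-2,1,2,2,0,0,0,0,0,0,-2], Vec [2,0,-2,-2,0,0,0,0,0,1,2],
     Grow 10 [Vec [-11,7,8,7,0,-3,-2,0,4,-6,0,-3], Grow 3 [Vec [3,-1,-2,-2,0,0,0,0,0,0,2,-2,2],
     Vec [-9,6,7,6,0,-3,0,0,0,-2,-3,2,-3]]], Vec [-6,3,6,3,0,0,0,0,2,-4,-3]],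
     Grow 3 [Vec [-2,1,2,2,0,0,0,0,0,0,-2], Vec [2,0,-2,-2,0,0,0,0,0,1,2],
     Grow 10 [Vec [-11,7,7,8,0,-3,-2,0,4,-6,0,-3], Grow 2 [Vec [3,-1,-2,-2,0,0,0,0,0,0,2,-2,2],
     Vec [-9,6,6,7,0,-3,0,0,0,-2,-3,2,-3]]], Vec [-6,3,3,6,0,0,0,0,2,-4,-3]],
     Grow 2 [Vec [-2,0,2,2,0,0,0,0,0,1,-2], Vec [-2,1,2,2,0,0,0,0,0,0,-2],
     Vec [-3,2,2,1,0,-2,0,2,-2,2,-2], Grow 2 [Vec [2,0,-2,-2,0,0,0,0,0,0,1,2],
     Vec [-2,1,2,2,0,0,0,0,0,0,0,-2], Vec [2,0,-2,-2,0,0,0,0,0,0,1,2],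
     Vec [3,-2,-2,-1,0,2,0,-2,2,-2,0,2], Vec [-2,2,3,0,0,-2,0,2,-2,2,-1,-2],
     Grow 10 [Vec [-3,0,0,6,0,0,2,2,-5,7,6,-3,-9],
     Grow 3 [Vec [3,-1,0,-4,0,0,0,0,1,-2,-1,-1,3,3], Vec [6,-4,-3,-6,0,2,0,0,0,0,0,0,3,3]],
     Vec [-11,8,7,7,0,-6,0,4,-2,0,0,-3,-3], Vec [5,-2,-5,-2,0,0,0,0,0,2,3,3,-4],
     Vec [-41,31,32,20,0,-22,-7,14,0,-6,-18,-7,12], Vec [-6,4,6,3,0,-2,0,0,0,0,-3,-3,3],
     Vec [-49,38,38,24,0,-29,-7,21,-7,0,-18,-10,9]], Vec [6,-4,-6,-3,0,2,0,0,0,0,3,3]]]],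
     Vec [0,0,0,0,2,-2,-2,2,1]], Grow 2 [Vec [-2,0,2,2,0,0,1,0,-2], Vec [-2,0,2,2,0,0,0,1,-2],
     Vec [-2,1,2,2,0,0,0,0,-2], Vec [-2,2,2,0,0,-2,1,2,-3], Vec [-3,2,2,1,-2,0,2,0,-2],
     Vec [-3,2,2,1,0,-2,0,2,-2], Grow 2 [Vec [2,0,-2,-2,0,0,0,0,1,2],
     Vec [2,0,-2,-2,0,0,0,0,1,2], Vec [-2,1,2,2,0,0,0,0,0,-2], Vec [2,0,-2,-2,0,0,0,0,1,2],
     Vec [3,0,-6,0,0,2,-3,-4,3,6], Vec [3,-2,-2,-1,2,0,-2,0,0,2], Vec [-2,2,3,0,-2,0,2,0,-1,-2],
     Vec [-3,2,2,1,0,-2,0,2,0,-2], Vec [2,-2,-3,0,0,2,0,-2,1,2],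
     Grow 8 [Vec [-3,0,0,7,-6,4,8,-2,7,-3,-11], Vec [-3,0,0,7,4,-6,-2,8,7,-3,-11],
     Grow 3 [Vec [0,0,-5,11,0,-4,6,8,5,5,-10,-12], Vec [3,-2,0,-4,0,1,-1,0,-1,-1,3,3],
     Vec [-2,2,0,3,0,-2,0,2,0,0,-1,-2], Vec [6,-4,-3,-6,0,2,0,0,0,0,3,3]],
     Vec [-9,7,6,6,-2,-3,0,2,0,-3,-3], Vec [-4,6,0,2,-4,-4,6,6,6,-3,-9],
     Vec [5,-2,-5,-2,0,0,2,0,3,3,-4], Grow 10 [Vec [3,-1,-2,-2,0,0,0,0,2,0,-2,2],
     Vec [0,0,0,0,-2,2,2,-2,1,0,-3,2], Vec [0,0,0,0,0,0,1,0,2,-2,-2,2],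
     Vec [0,0,0,-3,-6,4,8,-2,7,-3,-11,7], Vec [-3,2,2,1,0,-2,0,2,-2,0,2,-2],
     Grow 3 [Vec [-11,7,8,7,0,-3,0,0,0,-6,-2,4,-3], Vec [-11,7,8,7,0,-3,0,0,0,-6,-2,4,-3]],
     Vec [-11,8,9,5,-2,-4,0,2,-5,-2,3,-2], Vec [0,0,0,0,0,0,0,1,-2,2,2,-2],
     Vec [0,0,0,0,2,-2,-2,2,-1,0,3,-2], Vec [0,0,0,0,0,0,1,0,2,-2,-2,2],
     Vec [12,0,-18,-6,-22,14,31,-7,32,-7,-41,20]], Vec [-5,2,5,2,0,0,0,-2,-3,-3,4],
     Grow 10 [Vec [0,0,0,0,2,-2,-2,2,1,0,-3,2], Vec [3,-1,-2,-2,0,0,0,0,2,0,-2,2],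
     Vec [0,0,0,0,0,0,0,1,2,-2,-2,2], Vec [0,0,0,-3,4,-6,-2,8,7,-3,-11,7],
     Vec [3,-2,-2,-1,2,0,-2,0,2,0,-2,2], Vec [0,0,0,0,0,0,0,1,2,-2,-2,2],
     Vec [0,0,0,0,2,-2,-2,2,1,0,-3,2], Grow 3 [Vec [-11,7,8,7,0,-3,0,0,0,-6,-2,4,-3],
     Vec [-11,7,8,7,0,-3,0,0,0,-6,-2,4,-3]], Vec [-11,8,9,5,-4,-2,2,0,-5,-2,3,-2],
     Vec [0,0,0,0,0,0,0,1,2,-2,-2,2], Vec [12,0,-18,-6,14,-22,-7,31,32,-7,-41,20]],
     Vec [-6,4,6,3,0,-2,0,0,-3,-3,3], Vec [-10,8,8,5,-3,-3,2,2,-4,-2,2]],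
     Vec [6,-4,-6,-3,0,2,0,0,3,3]]]]], Grow 2 [Vec [-2,0,2,2,1,0,-2], Vec [-2,0,2,2,0,1,-2],
     Vec [-2,1,2,2,0,0,-2], Vec [0,-2,1,0,2,2,-2], Grow 2 [Vec [0,0,2,1,2,0,-2,-2],
     Vec [0,2,-2,-1,-2,-2,2,3], Vec [-2,3,0,2,-2,-1,2,-2], Vec [2,0,-2,-2,0,0,1,2],
     Vec [0,0,2,0,2,1,-2,-2], Grow 3 [Grow 3 [Known 1 [0,2,1,3,6,7,4,5,8,9],
     Vec [0,1,0,-2,0,-2,0,0,2,2], Vec [6,-6,-3,-4,3,3,0,0,0,2],
     Vec [11,0,-10,-12,-5,-4,5,5,8,6]], Vec [6,-6,-3,-4,3,3,0,0,2]], Vec [0,1,-2,0,-2,0,2,2],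
     Grow 4 [Vec [0,2,0,0,-2,-2,0,1,2], Grow 3 [Known 2 [0,2,1,3,6,7,4,5,8,9],
     Vec [0,-2,0,2,2,3,0,-1,-2,-2], Vec [3,-6,0,0,6,3,-3,0,-4,2], Vec [-2,0,2,3,2,0,-2,0,-2,-1]],
     Vec [0,2,0,0,-2,-2,0,1,2], Vec [-4,6,0,2,-6,-3,3,0,3]], Grow 4 [Vec [0,0,-2,-1,-2,-2,2,2,3],
     Grow 3 [Known 2 [1,4,0,5,6,8,2,3,7,9], Vec [0,-2,0,2,2,3,0,-1,-2,-2],
     Vec [0,0,2,-2,0,1,-2,-3,2,2], Vec [8,0,-9,-7,-4,-3,5,6,3,3]],
     Grow 3 [Known 4 [0,1,2,3,4,5,6,7,8,9], Vec [0,3,0,-4,-6,0,3,-3,6,2],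
     Vec [0,0,2,-2,0,1,-2,-3,2,2], Vec [0,0,3,-4,-3,3,0,-6,6,2]], Vec [0,-2,2,0,3,2,-2,-2,-1],
     Vec [0,2,0,0,-2,-2,0,1,2], Vec [0,2,0,0,-2,-2,1,0,2], Vec [0,2,0,0,-2,-2,0,1,2],
     Vec [0,0,2,0,0,1,-2,-2,2], Vec [-6,3,6,3,0,0,-4,-3,2], Vec [-4,0,6,2,0,3,-3,-6,3],
     Vec [0,-2,2,0,3,2,-2,-2,-1]], Vec [6,-6,-4,-3,3,3,0,2], Vec [6,-4,-6,-3,0,2,3,3]],
     Grow 2 [Vec [0,-2,2,1,2,2,-2,-3], Vec [0,0,2,1,0,2,-2,-2], Vec [-2,3,0,2,-1,-2,2,-2],
     Vec [2,0,-2,-2,0,0,1,2], Vec [0,0,2,0,1,2,-2,-2], Grow 4 [Vec [0,2,0,0,-2,-2,0,1,2],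
     Grow 3 [Known 2 [0,2,1,3,6,7,5,4,9,8], Vec [0,-2,0,2,3,2,0,-1,-2,-2],
     Vec [3,-6,0,0,6,3,0,-3,-4,2], Vec [-2,0,2,3,2,0,0,-2,-2,-1]], Vec [0,2,0,0,-2,-2,0,1,2],
     Vec [-4,6,0,2,-6,-3,0,3,3]], Grow 4 [Vec [0,0,-2,-1,-2,-2,2,2,3],
     Grow 3 [Known 4 [0,1,2,3,4,5,7,6,8,9], Vec [0,3,0,-4,-6,0,-3,3,6,2],
     Vec [0,0,-2,2,0,-1,3,2,-2,-2], Vec [0,0,3,-4,-3,3,-6,0,6,2]],
     Grow 3 [Known 2 [1,4,0,5,7,8,2,3,6,9], Vec [0,-2,0,2,2,3,-1,0,-2,-2],
     Vec [0,0,-2,2,0,-1,3,2,-2,-2], Vec [8,0,-9,-7,-4,-3,6,5,3,3]], Vec [0,2,-2,0,-3,-2,2,2,1],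
     Vec [0,2,0,0,-2,-2,0,1,2], Vec [0,2,0,0,-2,-2,1,0,2], Vec [0,2,0,0,-2,-2,0,1,2],
     Vec [0,0,2,0,0,1,-2,-2,2], Vec [-4,0,6,2,0,3,-6,-3,3], Vec [-6,3,6,3,0,0,-3,-4,2],
     Vec [0,-2,2,0,3,2,-2,-2,-1]], Grow 3 [Grow 3 [Known 1 [0,2,1,3,6,7,5,4,8,9],
     Vec [0,1,0,-2,-2,0,0,0,2,2], Vec [6,-6,-3,-4,3,3,0,0,0,2],
     Vec [11,0,-10,-12,-4,-5,5,5,8,6]], Vec [6,-6,-3,-4,3,3,0,0,2]], Vec [0,1,-2,0,0,-2,2,2],
     Vec [6,-6,-4,-3,3,3,0,2], Vec [6,-4,-6,-3,2,0,3,3]], Vec [6,-6,-4,-3,3,3,2]]]]"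

text \<open>The first branch excludes a common outside neighbour of the two nonadjacent vertices of
  the diamond: its vector has form - 30 and squared norm 14.\<close>

definition diamond_cert :: cert where
  "diamond_cert =
     Grow 0 [Vec [-2,1,1,-2,2],
     Grow 3 [Grow 4 [Grow 6 [Grow 7 [Grow 7 [Grow 8 [Vec [3,-2,-2,3,-2,-2,4,-4,2,2,-2],
     Grow 9 [Grow 10 [Grow 12 [Grow 13 [Grow 13 [Vec [21,-14,-14,21,-15,-15,25,-21,9,9,-6,-6,9,-6,2,2],
     Vec [6,-4,-4,6,-4,-4,7,-6,0,5,0,-4,4,-4,2,2]]]], Vec [0,0,0,0,0,0,0,0,2,-2,-2,2,1]],
     Grow 10 [Vec [3,-2,-2,3,-2,-2,4,-4,2,2,-2,-2,2],
     Grow 10 [Vec [-3,2,2,-3,2,2,-4,4,-2,-2,2,2,0,-2], Vec [2,0,-2,2,-2,-2,4,-4,3,1,-4,-2,2,3],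
     Grow 12 [Vec [0,0,0,0,0,0,0,0,-2,2,2,-2,-1,-1,2],
     Grow 11 [Known 0 [0,1,2,3,4,5,6,7,8,9,10,11,12,13,15,14],
     Vec [0,0,0,0,0,0,0,0,-2,2,2,-3,0,-2,1,2], Vec [8,-5,-5,8,-6,-6,10,-8,3,4,-2,-3,0,1,1,1],
     Vec [0,0,0,0,0,0,0,0,-2,2,2,-3,-2,0,2,1]], Vec [-4,3,3,-4,3,3,-5,4,-4,0,4,0,-2,-2,2],
     Vec [14,-9,-9,14,-10,-10,17,-14,8,4,-6,-2,3,2,-1]],
     Vec [4,-3,-3,4,-3,-3,5,-4,4,0,-4,0,2,2]]]]], Vec [3,-2,-2,3,-2,-2,4,-4,2,2]]]],
     Grow 5 [Vec [0,0,0,1,2,-2,-2,2], Grow 6 [Grow 6 [Known 1 [4,0,5,6,1,2,3,7,8,9],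
     Vec [0,0,0,0,0,1,-2,-2,2,2], Vec [-3,0,0,3,6,-6,-4,3,0,2], Vec [-3,0,0,2,6,-4,-6,0,3,3]],
     Vec [-3,0,0,3,6,-6,-4,3,2]]]], Grow 4 [Vec [2,-1,-1,2,-2,-2,2],
     Grow 4 [Vec [2,-1,-1,2,-2,-2,0,2], Vec [-2,0,2,-2,3,2,-1,-2],
     Grow 6 [Grow 5 [Vec [0,0,-2,4,3,-6,-3,-3,6,3]], Grow 5 [Known 5 [0,1,2,3,4,5,6,7,8,9],
     Vec [3,-3,-3,6,0,-6,0,-2,3,4], Grow 7 [Vec [3,-2,-2,3,-2,-2,0,2,0,2,-2],
     Grow 9 [Grow 10 [Vec [36,-25,-25,40,-23,-32,0,11,7,18,0,-12,6],
     Vec [0,0,0,0,0,0,-2,2,2,-2,-3,2,1]], Vec [-9,6,6,-9,6,7,0,-4,-2,-3,2,2]]],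
     Vec [3,-3,-3,6,0,-6,-2,0,4,3]], Vec [-5,3,3,-4,5,2,-2,-2,2],
     Grow 7 [Vec [0,0,0,0,0,1,-2,2,2,-2], Grow 5 [Vec [-3,2,2,-3,2,2,-2,0,2,0,-2],
     Vec [0,0,0,1,0,-3,2,-2,-2,2,2], Grow 10 [Grow 8 [Vec [11,-7,-7,11,-8,-8,0,5,2,-2,8,-6,2],
     Vec [0,0,0,0,0,0,-2,2,3,-2,2,-2,-1]], Vec [-9,6,6,-9,6,7,-4,0,2,-2,-3,2]],
     Vec [3,-3,-3,6,0,-6,0,-2,0,4,3]], Grow 8 [Vec [-3,2,2,-3,2,2,0,-2,0,2,-2],
     Vec [0,0,0,0,0,0,2,-2,-2,2,1],
     Grow 10 [Grow 5 [Vec [36,-25,-25,40,-23,-32,0,11,6,0,-12,18,7],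
     Vec [3,-3,-3,6,0,-6,0,0,0,0,-2,4,3]], Grow 5 [Vec [-3,2,2,-3,2,2,0,-2,0,2,-2,2,-2],
     Vec [-16,10,10,-14,13,9,0,-10,-2,8,-4,2,-5]]], Vec [0,0,0,0,0,0,2,-2,-2,2,1]],
     Grow 5 [Vec [0,2,2,-6,3,8,-3,-3,7,7,-11], Vec [3,-2,-2,3,-2,-2,2,0,-2,0,2],
     Vec [3,-2,-2,3,-2,-2,0,2,0,-2,2], Vec [-19,12,12,-17,15,11,-6,-6,3,3,-5]]]],
     Vec [5,-3,-3,4,-5,-2,2,2]]]]]"

lemma check_diamond: "check (extremal # order_ten) diamond diamond_cert"
  by code_simp

lemma check_claw: "check (extremal # order_ten) claw claw_cert"
  by code_simp

text \<open>The identities are completions of squares: the first square takes up all terms with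
  \<open>a\<close>, and the positive factor on the left keeps the coefficients integral. The fourth
  graph is the Petersen graph.\<close>

lemma order_ten_form:
  fixes y :: "real list"
  assumes "K \<in> set order_ten" "length y = 10"
  shows "- 2 * sqnorm y \<le> list_form K y"
proof -
  obtain a b c d e f g h i j where y: "y = [a, b, c, d, e, f, g, h, i, j]"
    using assms(2) by (auto simp: numeral_eq_Suc length_Suc_conv)
  note expand = list_form_def sqnorm_def upt_rec_numeral
  have "0 \<le> list_form [[1,2,3],[0,4,5],[0,6,7],[0,8,9],[1,5,6],[1,4,6],[2,4,5],[2,8,9],[3,7,9],[3,7,8]] y + 2 * sqnorm y"
  proof -
    have "12 * (list_form [[1,2,3],[0,4,5],[0,6,7],[0,8,9],[1,5,6],[1,4,6],[2,4,5],[2,8,9],[3,7,9],[3,7,8]] y + 2 * sqnorm y) =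
        6 * (2 * a + b + c + d)\<^sup>2 + 6 * (b + 2 * e + f + g)\<^sup>2 + 2 * (b + 3 * f +
        g)\<^sup>2 + (- 2 * b + 3 * c + 4 * g)\<^sup>2 + 6 * (b - d)\<^sup>2 + (3 * c - 2 * d +
        4 * h)\<^sup>2 + 2 * (2 * d + 2 * h + 3 * i + 3 * j)\<^sup>2 + 6 * (i - j)\<^sup>2"
      unfolding y by (simp add: expand power2_eq_square algebra_simps)
    also have "\<dots> \<ge> 0" by simp
    finally show ?thesis by simp
  qed
  moreover
  have "0 \<le> list_form [[1,2,3],[0,4,5],[0,6,7],[0,8,9],[1,5,6],[1,4,7],[2,4,8],[2,5,9],[3,6,9],[3,7,8]] y + 2 * sqnorm y"
  proof -
    have "30 * (list_form [[1,2,3],[0,4,5],[0,6,7],[0,8,9],[1,5,6],[1,4,7],[2,4,8],[2,5,9],[3,6,9],[3,7,8]] y + 2 * sqnorm y) =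
        15 * (2 * a + b + c + d)\<^sup>2 + 15 * (b + 2 * e + f + g)\<^sup>2 + 5 * (b + 3 * f - g
        + 2 * h)\<^sup>2 + 15 * (d + g + 2 * i + j)\<^sup>2 + 5 * (d - g + 2 * h + 3 *
        j)\<^sup>2 + (5 * b - 3 * c - 3 * d - 2 * g - 2 * h)\<^sup>2 + 4 * (3 * c - 2 * d + 2 *
        g + 2 * h)\<^sup>2"
      unfolding y by (simp add: expand power2_eq_square algebra_simps)
    also have "\<dots> \<ge> 0" by simp
    finally show ?thesis by simp
  qed
  moreover
  have "0 \<le> list_form [[1,2,3],[0,4,5],[0,6,7],[0,8,9],[1,5,6],[1,4,8],[2,4,7],[2,6,9],[3,5,9],[3,7,8]] y + 2 * sqnorm y"
  proof -
    have "210 * (list_form [[1,2,3],[0,4,5],[0,6,7],[0,8,9],[1,5,6],[1,4,8],[2,4,7],[2,6,9],[3,5,9],[3,7,8]] y + 2 * sqnorm y) =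
        105 * (2 * a + b + c + d)\<^sup>2 + 105 * (b + 2 * e + f + g)\<^sup>2 + 35 * (b + 3 * f
        - g + 2 * i)\<^sup>2 + 105 * (c + g + 2 * h + j)\<^sup>2 + 7 * (5 * b - 3 * c - 3 * d -
        2 * g - 2 * i)\<^sup>2 + 3 * (7 * c - 8 * d + 3 * g - 2 * i - 5 * j)\<^sup>2 + 15 * (2 *
        d + g + 4 * i + 3 * j)\<^sup>2 + 105 * (g - j)\<^sup>2"
      unfolding y by (simp add: expand power2_eq_square algebra_simps)
    also have "\<dots> \<ge> 0" by simp
    finally show ?thesis by simp
  qed
  moreover
  have "0 \<le> list_form [[1,2,3],[0,4,5],[0,6,7],[0,8,9],[1,6,8],[1,7,9],[2,4,9],[2,5,8],[3,4,7],[3,5,6]] y + 2 * sqnorm y"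
  proof -
    have "6 * (list_form [[1,2,3],[0,4,5],[0,6,7],[0,8,9],[1,6,8],[1,7,9],[2,4,9],[2,5,8],[3,4,7],[3,5,6]] y + 2 * sqnorm y) =
        3 * (2 * a + b + c + d)\<^sup>2 + 3 * (b + 2 * e + g + i)\<^sup>2 + 3 * (b + 2 * f + h +
        j)\<^sup>2 + (- b + 3 * c - d + 2 * g + 2 * h)\<^sup>2 + (- b + 2 * d - g + 2 * h + 3 *
        i)\<^sup>2 + (b - 2 * d - 2 * g + h - 3 * j)\<^sup>2"
      unfolding y by (simp add: expand power2_eq_square algebra_simps)
    also have "\<dots> \<ge> 0" by simp
    finally show ?thesis by simp
  qed
  moreover
  have "0 \<le> list_form [[1,2,4],[0,2,3],[0,1,3],[1,2,5],[0,6,7],[3,8,9],[4,7,8],[4,6,9],[5,6,9],[5,7,8]] y + 2 * sqnorm y"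
  proof -
    have "12 * (list_form [[1,2,4],[0,2,3],[0,1,3],[1,2,5],[0,6,7],[3,8,9],[4,7,8],[4,6,9],[5,6,9],[5,7,8]] y + 2 * sqnorm y) =
        6 * (2 * a + b + c + e)\<^sup>2 + 2 * (3 * b + c + 2 * d - e)\<^sup>2 + (4 * c + 2 * d -
        e)\<^sup>2 + 3 * (2 * d + e + 2 * f)\<^sup>2 + 3 * (2 * e - f + 2 * g + 2 * h)\<^sup>2 +
        3 * (f + 2 * g + 2 * i)\<^sup>2 + 3 * (f + 2 * h + 2 * j)\<^sup>2 + 3 * (f + 2 * i + 2 *
        j)\<^sup>2"
      unfolding y by (simp add: expand power2_eq_square algebra_simps)
    also have "\<dots> \<ge> 0" by simp
    finally show ?thesis by simp
  qed
  ultimately show ?thesis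
    using assms(1) by (auto simp: order_ten_def)
qed

section \<open>The extremal graph\<close>

definition beta_poly :: "real poly" where
  "beta_poly = [:-4, -35, 13, 21, -7, -3, 1:]"

text \<open>In the distance \<open>t\<close> below - 2, all coefficients except the constant one are
  positive. So the polynomial increases for \<open>t > 0\<close> and has at most one root below -
  2.\<close>

lemma beta_poly_at: "poly beta_poly (- 2 - t) = t^6 + 15 * t^5 + 83 * t^4 + 203 * t^3 + 199 * t\<^sup>2 + 43 * t - 2"
  by (simp add: beta_poly_def eval_nat_numeral algebra_simps)

lemma beta_poly_root_unique:
  assumes "poly beta_poly x = 0" "poly beta_poly y = 0" "x < - 2" "y < - 2"
  shows "x = y"
proof -
  have "poly beta_poly (- 2 - s) < poly beta_poly (- 2 - t)" if "0 < s" "s < t" for s t :: real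
  proof -
    have "s ^ n \<le> t ^ n" for n using that by (intro power_mono) auto
    note this[of 2] this[of 3] this[of 4] this[of 5] this[of 6]
    then show ?thesis unfolding beta_poly_at using that by linarith
  qed
  from this[of "- 2 - x" "- 2 - y"] this[of "- 2 - y" "- 2 - x"] show ?thesis
    using assms by fastforce
qed

text \<open>A sign change between - 2.0392 and - 2 produces a root, and it is the smallest one
  because no other root lies below - 2.\<close>

lemma beta_root: "poly beta_poly beta = 0"
  and beta_less: "beta < - 2"
  and beta_greater: "- 20392 / 10000 < beta"
proof -
  have "poly beta_poly (- 2) < 0" "poly beta_poly (- 20392 / 10000) > 0"
    by (simp_all add: beta_poly_def)
  then obtain x where x: "- 20392 / 10000 < x" "x < - 2" "poly beta_poly x = 0"
    using poly_IVT_neg[of "- 20392 / 10000" "- 2" beta_poly] by auto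
  have "finite {x. poly beta_poly x = 0}"
    by (rule poly_roots_finite) (simp add: beta_poly_def)
  moreover have "x \<le> y" if "poly beta_poly y = 0" for y
    using beta_poly_root_unique[OF x(3) that x(2)] x(2) by (cases "y < - 2") auto
  ultimately have "Min {x. poly beta_poly x = 0} = x"
    using x(3) by (intro Min_eqI) auto
  then have "beta = x"
    by (simp add: beta_def beta_poly_def)
  with x show "poly beta_poly beta = 0" "beta < - 2" "- 20392 / 10000 < beta" by auto
qed

definition list_eigenvector :: "nat list list \<Rightarrow> real \<Rightarrow> real list \<Rightarrow> bool" where
  "list_eigenvector K c y \<longleftrightarrow> length y = length K \<and>
     (\<forall>i<length K. (\<Sum>j\<leftarrow>K ! i. y ! j) = c * y ! i)"

lemma list_form_eigenvector: "list_eigenvector K c y \<Longrightarrow> list_form K y = c * sqnorm y"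
proof -
  assume y: "list_eigenvector K c y"
  have "sqnorm y = (\<Sum>i=0..<length K. y ! i * y ! i)"
    using y by (simp add: sqnorm_def sum_list_sum_nth list_eigenvector_def)
  then show ?thesis
    using y by (simp add: list_eigenvector_def list_form_def interv_sum_list_conv_sum_set_nat
        sum_distrib_left algebra_simps)
qed

lemma sqnorm_pos: "t \<in> set y \<Longrightarrow> t \<noteq> 0 \<Longrightarrow> 0 < sqnorm (y :: real list)"
proof (induction y)
  case (Cons a y)
  have "0 \<le> sqnorm y" by (auto simp: sqnorm_def intro!: sum_list_nonneg)
  moreover have "a \<noteq> 0 \<Longrightarrow> 0 < a * a"
    using zero_less_power2[of a] by (simp add: power2_eq_square)
  ultimately show ?case
    using Cons by (auto simp: sqnorm_def intro: add_pos_nonneg add_nonneg_pos)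
qed simp

text \<open>The graph has automorphisms exchanging 1 with 2, exchanging 12 with 13 and 14 with 15, and mapping
  \<open>(0, 4, 8, 10, 12, 13)\<close> to \<open>(3, 5, 9, 11, 15, 14)\<close> and back. For \<open>m < - 2\<close> an eigenvector must be
  invariant under them; then all its entries are polynomials in \<open>m\<close> times the entry at 1, and the
  last equation reads \<open>(m - 3) (m + 1) p(m) = 0\<close>.\<close>

lemma extremal_eigenvalue:
  assumes y: "list_eigenvector extremal m y" and m: "m < - 2" and nz: "\<exists>t\<in>set y. t \<noteq> 0"
  shows "m = beta"
proof -
  \<comment> \<open>\<open>z0\<close> to \<open>z5\<close> are the entries at the vertices 10 to
    15.\<close>
  obtain y0 y1 y2 y3 y4 y5 y6 y7 y8 y9 z0 z1 z2 z3 z4 z5 where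
    ys: "y = [y0, y1, y2, y3, y4, y5, y6, y7, y8, y9, z0, z1, z2, z3, z4, z5]"
    using y by (auto simp: list_eigenvector_def extremal_def numeral_eq_Suc length_Suc_conv)
  have eqs: "y1 + y2 + y4 = m * y0" "y0 + y2 + y3 = m * y1" "y0 + y1 + y3 = m * y2"
    "y1 + y2 + y5 = m * y3" "y0 + y5 + y6 = m * y4" "y3 + y4 + y6 = m * y5"
    "y4 + y5 + y7 = m * y6" "y6 + y8 + y9 = m * y7" "y7 + y9 + z0 = m * y8" "y7 + y8 + z1 = m * y9"
    "y8 + z2 + z3 = m * z0" "y9 + z4 + z5 = m * z1" "z0 + z3 + z5 = m * z2" "z0 + z2 + z4 = m * z3"
    "z1 + z3 + z5 = m * z4" "z1 + z2 + z4 = m * z5"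
    using y unfolding list_eigenvector_def ys
    by (simp_all add: extremal_def All_less_Suc2 numeral_eq_Suc algebra_simps)
  have "(m + 1) * (y1 - y2) = 0" using eqs(2,3) by (simp add: algebra_simps)
  then have y12: "y1 = y2" using m by simp
  have C: "y4 - y5 = m * (y0 - y3)" using eqs(1,4) by (simp add: algebra_simps)
  moreover have "y0 - y3 = (m + 1) * (y4 - y5)" using eqs(5,6) by (simp add: algebra_simps)
  ultimately have "y4 - y5 = m * ((m + 1) * (y4 - y5))" by simp
  then have "(m * (m + 1) - 1) * (y4 - y5) = 0" by (simp add: algebra_simps)
  \<comment> \<open>\<open>m * (m + 1) - 1\<close> exceeds this product by 1, so it is positive
    below - 2.\<close>
  moreover have "(m + 2) * (m - 1) > 0" using m by (intro mult_neg_neg) auto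
  then have "m * (m + 1) - 1 \<noteq> 0" by (simp add: algebra_simps)
  ultimately have y45: "y4 = y5" unfolding mult_eq_0_iff by simp
  then have y03: "y0 = y3" using C m by simp
  \<comment> \<open>The quantities \<open>y8 - y9\<close>, \<open>z0 - z1\<close> and
    \<open>z2 + z3 - z4 - z5\<close> change sign under the map exchanging 8 and 9, and they satisfy
    a closed linear system. Eliminating the last two leaves the factor
    \<open>(m + 2) * (m * (m - 1) - 1)\<close>, which is nonzero below - 2.\<close>
  have z: "z0 - z1 = (m + 1) * (y8 - y9)" using eqs(9,10) by (simp add: algebra_simps)
  have "m * (z2 + z3 - z4 - z5) = 2 * (z0 - z1)" using eqs(13-16) by (simp add: algebra_simps)
  moreover have "z2 + z3 - z4 - z5 = m * (z0 - z1) - (y8 - y9)" using eqs(11,12) by (simp add: algebra_simps)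
  ultimately have "m * (m * ((m + 1) * (y8 - y9)) - (y8 - y9)) = 2 * ((m + 1) * (y8 - y9))"
    by (simp only: z)
  then have "((m + 2) * (m * (m - 1) - 1)) * (y8 - y9) = 0" by (simp add: algebra_simps)
  moreover have "m * (m - 1) > 2 * 1" using m mult_strict_mono'[of 2 "- m" 1 "1 - m"] by (simp add: algebra_simps)
  then have "(m + 2) * (m * (m - 1) - 1) \<noteq> 0" using m by simp
  ultimately have y89: "y8 = y9" unfolding mult_eq_0_iff[of _ "y8 - y9"] by simp
  then have z01: "z0 = z1" using z by simp
  have "m * (z2 - z4) = 0" "m * (z3 - z5) = 0" using eqs(13-16) z01 by (simp_all add: algebra_simps)
  then have z24: "z2 = z4" "z3 = z5" using m by simp_all
  have "(m + 2) * (z2 - z3) = 0" using eqs(13,14) z24 by (simp add: algebra_simps)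
  then have z23: "z2 = z3" using m by simp
  \<comment> \<open>The orbits form a path, from that of 1 through those of 0, 4, 6, 7, 8 and 10 to
    that of 12, so each equation determines the next value from the earlier ones. The equation at
    the end of the path is left over as the condition on \<open>m\<close>.\<close>
  have b: "y0 = (m - 1) * y1 / 2" using eqs(2) y12 y03 by (simp add: algebra_simps)
  have c: "y4 = m * y0 - 2 * y1" using eqs(1) y12 by (simp add: algebra_simps)
  have d: "y6 = (m - 1) * y4 - y0" using eqs(5) y45 by (simp add: algebra_simps)
  have e: "y7 = m * y6 - 2 * y4" using eqs(7) y45 by (simp add: algebra_simps)
  have f: "y8 = (m * y7 - y6) / 2" using eqs(8) y89 by (simp add: algebra_simps)
  have g: "z0 = (m - 1) * y8 - y7" using eqs(9) y89 by (simp add: algebra_simps)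
  have h: "z2 = (m * z0 - y8) / 2" using eqs(11) z23 by (simp add: algebra_simps)
  have i: "(m - 2) * z2 - z0 = 0" using eqs(13) z23 z24 by (simp add: algebra_simps)
  have "y1 \<noteq> 0"
  proof
    assume "y1 = 0"
    then have "y0 = 0" using b by simp
    with \<open>y1 = 0\<close> c have "y4 = 0" by simp
    with \<open>y0 = 0\<close> d have "y6 = 0" by simp
    with \<open>y4 = 0\<close> e have "y7 = 0" by simp
    with \<open>y6 = 0\<close> f have "y8 = 0" by simp
    with \<open>y7 = 0\<close> g have "z0 = 0" by simp
    with \<open>y8 = 0\<close> h have "z2 = 0" by simp
    with nz show False
      using \<open>y1 = 0\<close> \<open>y0 = 0\<close> \<open>y4 = 0\<close> \<open>y6 = 0\<close> \<open>y7 = 0\<close> \<open>y8 = 0\<close> \<open>z0 = 0\<close>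
        y12 y03 y45 y89 z01 z24 z23 by (auto simp: ys)
  qed
  moreover have "(m - 3) * (m + 1) * poly beta_poly m * y1 = 0"
  proof -
    have "poly beta_poly m = m^6 - 3 * m^5 - 7 * m^4 + 21 * m^3 + 13 * m\<^sup>2 - 35 * m - 4"
      by (simp add: beta_poly_def eval_nat_numeral algebra_simps)
    moreover have "(m - 3) * (m + 1) * (m^6 - 3 * m^5 - 7 * m^4 + 21 * m^3 + 13 * m\<^sup>2 - 35 * m - 4) * y1 = 0"
    proof -
      \<comment> \<open>The 8 clears the three halvings in \<open>b\<close>, \<open>f\<close> and
        \<open>h\<close>. The polynomial in \<open>m\<close> on the left is the characteristic
        polynomial of the 8 by 8 quotient matrix over the orbits; its root 3 belongs to the constant
        vector.\<close>
      have "(m - 3) * (m + 1) * (m^6 - 3 * m^5 - 7 * m^4 + 21 * m^3 + 13 * m\<^sup>2 - 35 * m - 4) * y1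
          = 8 * ((m - 2) * z2 - z0)"
        unfolding h unfolding g unfolding f unfolding e unfolding d unfolding c unfolding b
        by (simp add: field_simps eval_nat_numeral)
      then show ?thesis unfolding i by simp
    qed
    ultimately show ?thesis by simp
  qed
  ultimately have "poly beta_poly m = 0" using m by simp
  then show ?thesis by (rule beta_poly_root_unique[OF _ beta_root m beta_less])
qed

text \<open>The same recursion along the path of orbits, started with the value 1 at vertex 1, which
  makes the vector nonzero. All equations but the last hold by construction, and the last one
  because \<open>beta\<close> is a root.\<close>

lemma extremal_beta:
  obtains y where "list_eigenvector extremal beta y" "y ! 1 = 1"
proof -
  define b where "b = (beta - 1) / 2"
  define c where "c = beta * b - 2"
  define d where "d = (beta - 1) * c - b"
  define e where "e = beta * d - 2 * c"
  define f where "f = (beta * e - d) / 2"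
  define g where "g = (beta - 1) * f - e"
  define h where "h = (beta * g - f) / 2"
  note defs = b_def c_def d_def e_def f_def g_def h_def
  have "poly beta_poly beta = beta^6 - 3 * beta^5 - 7 * beta^4 + 21 * beta^3 + 13 * beta\<^sup>2 - 35 * beta - 4"
    by (simp add: beta_poly_def eval_nat_numeral algebra_simps)
  then have r: "beta^6 - 3 * beta^5 - 7 * beta^4 + 21 * beta^3 + 13 * beta\<^sup>2 - 35 * beta - 4 = 0"
    using beta_root by simp
  have eqs: "1 + 2 * b = beta * 1" "2 + c = beta * b" "b + c + d = beta * c" "2 * c + e = beta * d"
    "d + 2 * f = beta * e" "e + f + g = beta * f" "f + 2 * h = beta * g"
    unfolding defs by (simp_all add: field_simps)
  have "8 * ((beta - 2) * h - g) = (beta - 3) * (beta + 1) *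
      (beta^6 - 3 * beta^5 - 7 * beta^4 + 21 * beta^3 + 13 * beta\<^sup>2 - 35 * beta - 4)"
    unfolding h_def unfolding g_def unfolding f_def unfolding e_def unfolding d_def unfolding c_def
    unfolding b_def by (simp add: field_simps eval_nat_numeral)
  then have "g + 2 * h = beta * h" unfolding r by (simp add: algebra_simps)
  with eqs have "list_eigenvector extremal beta [b, 1, 1, b, c, c, d, e, f, f, g, g, h, h, h, h]"
    unfolding list_eigenvector_def
    by (simp add: extremal_def All_less_Suc2 numeral_eq_Suc algebra_simps)
  then show thesis by (rule that) simp
qed

section \<open>From embedded cubic graphs to components\<close>

lemma embeds_closed:
  assumes G: "regular_graph 3 G" and e: "embeds G K ws" and K: "\<And>ns. ns \<in> set K \<Longrightarrow> length ns = 3"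
    and v: "v \<in> set ws"
  shows "nbr G v \<subseteq> set ws"
proof -
  obtain i where i: "i < length K" "v = ws ! i"
    using e v by (auto simp: embeds_def in_set_conv_nth)
  have "v \<in> pverts G" using e v by (auto simp: embeds_def)
  have "card (nbr G v \<inter> set ws) = length (K ! i)"
    using embeds_sum_nbr[OF e i(1), of "\<lambda>_. 1 :: nat"] i by (simp add: sum_list_triv)
  \<comment> \<open>A row of length 3 already accounts for all neighbours of \<open>v\<close>, so no
    edge leaves the copy.\<close>
  also have "\<dots> = card (nbr G v)"
    using K[OF nth_mem[OF i(1)]] regular_graphD(3)[OF G \<open>v \<in> pverts G\<close>] by simp
  finally have "nbr G v \<inter> set ws = nbr G v"
    using finite_nbr[OF regular_graphD(1)[OF G]] by (intro card_subset_eq) auto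
  then show ?thesis by blast
qed

lemma embeds_list_eigenvector:
  assumes G: "regular_graph 3 G" and e: "embeds G K ws" and K: "\<And>ns. ns \<in> set K \<Longrightarrow> length ns = 3"
    and x: "\<And>v. v \<in> pverts G \<Longrightarrow> (\<Sum>u\<in>nbr G v. x u) = c * x v"
  shows "list_eigenvector K c (map x ws)"
  unfolding list_eigenvector_def
proof (intro conjI allI impI)
  have len: "length ws = length K" using e by (simp add: embeds_def)
  then show "length (map x ws) = length K" by simp
  fix i assume i: "i < length K"
  then have mem: "ws ! i \<in> set ws" using len by simp
  have "(\<Sum>j\<leftarrow>K ! i. map x ws ! j) = (\<Sum>j\<leftarrow>K ! i. x (ws ! j))"
    using e i len by (intro arg_cong[where f = sum_list] map_cong) (auto simp: embeds_def subset_iff)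
  also have "\<dots> = (\<Sum>u\<in>nbr G (ws ! i) \<inter> set ws. x u)"
    by (rule embeds_sum_nbr[OF e i, symmetric])
  also have "nbr G (ws ! i) \<inter> set ws = nbr G (ws ! i)"
    using embeds_closed[OF G e K mem] by blast
  also have "(\<Sum>u\<in>nbr G (ws ! i). x u) = c * map x ws ! i"
  proof -
    have "ws ! i \<in> pverts G" using e mem by (auto simp: embeds_def)
    then show ?thesis using x i len by simp
  qed
  finally show "(\<Sum>j\<leftarrow>K ! i. map x ws ! j) = c * map x ws ! i" .
qed

lemma extremal_cubic: "ns \<in> set extremal \<Longrightarrow> length ns = 3"
  by (auto simp: extremal_def)

lemma order_ten_cubic: "K \<in> set order_ten \<Longrightarrow> ns \<in> set K \<Longrightarrow> length ns = 3"
  and order_ten_length: "K \<in> set order_ten \<Longrightarrow> length K = 10"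
  by (auto simp: order_ten_def)

lemma rtrancl_closed:
  assumes "(u, v) \<in> (parcs G)\<^sup>*" "u \<in> S" "\<And>w. w \<in> S \<Longrightarrow> nbr G w \<subseteq> S"
  shows "v \<in> S"
  using assms by (induction rule: rtrancl_induct) (auto simp: nbr_def)

theorem smallest_eigenvalue_gap:
  assumes G: "regular_graph 3 G" and less: "smallest_eigenvalue G < - 2" and ge: "beta \<le> smallest_eigenvalue G"
  obtains ws where "embeds G extremal ws" "smallest_eigenvalue G = beta"
proof -
  note G' = regular_graphD(1,2)[OF G]
  let ?m = "smallest_eigenvalue G"
  obtain x v where x: "v \<in> pverts G" "x v \<noteq> 0"
    "\<And>v. v \<in> pverts G \<Longrightarrow> (\<Sum>u\<in>nbr G v. x u) = ?m * x v"
    using smallest_eigenvalue_in[OF G'] graph_eigenvalues_iff[OF G'(1)] by blast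
  define C where "C = {u. (v, u) \<in> (parcs G)\<^sup>*}"
  have closed: "nbr G u \<subseteq> C" if "u \<in> C" for u
    using that by (auto simp: C_def nbr_def intro: rtrancl_into_rtrancl)
  have C: "C \<subseteq> pverts G"
    using rtrancl_closed[of v _ G "pverts G"] x(1) nbr_subset[OF G'(1)] by (auto simp: C_def)
  have "sym ((parcs G)\<^sup>*)"
    using arcs_sym[OF G'(1)] by (intro sym_rtrancl symI)
  then have reach_v: "(u, v) \<in> (parcs G)\<^sup>*" if "u \<in> C" for u
    using that by (auto simp: C_def dest: symD)
  obtain H vs where H: "H = claw \<or> H = diamond" "embeds G H vs" "set vs \<inter> C \<noteq> {}"
  proof (rule ccontr)
    assume "\<not> thesis"
    then have "\<And>vs. embeds G claw vs \<Longrightarrow> set vs \<inter> C = {}" "\<And>vs. embeds G diamond vs \<Longrightarrow> set vs \<inter> C = {}"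
      using that by blast+
    from claw_diamond_free_form[OF G C closed this, of x]
    have "- 2 * (\<Sum>u\<in>C. (x u)\<^sup>2) \<le> (\<Sum>u\<in>C. x u * (\<Sum>w\<in>nbr G u. x w))" by blast
    also have "\<dots> = ?m * (\<Sum>u\<in>C. (x u)\<^sup>2)"
      unfolding sum_distrib_left[of ?m]
    proof (intro sum.cong refl)
      fix u assume "u \<in> C"
      then have "(\<Sum>w\<in>nbr G u. x w) = ?m * x u" using x(3) C by blast
      then show "x u * (\<Sum>w\<in>nbr G u. x w) = ?m * (x u)\<^sup>2" by (simp add: power2_eq_square)
    qed
    finally have "0 \<le> (?m + 2) * (\<Sum>u\<in>C. (x u)\<^sup>2)" by (simp add: algebra_simps)
    moreover have "0 < (\<Sum>u\<in>C. (x u)\<^sup>2)"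
    proof (rule sum_pos2)
      show "finite C" using C finite_pverts[OF G'(1)] finite_subset by blast
      show "v \<in> C" by (simp add: C_def)
    qed (use x(2) in auto)
    ultimately show False using less by (simp add: zero_le_mult_iff)
  qed
  have "- 20392 / 10000 \<le> ?m" using ge beta_greater by simp
  then obtain K ws where K: "K \<in> set (extremal # order_ten)" "embeds G K ws" "set vs \<subseteq> set ws"
    using check_sound[OF G _ check_claw, of vs] check_sound[OF G _ check_diamond, of vs] H by blast
  then have cubic: "ns \<in> set K \<Longrightarrow> length ns = 3" for ns
    using extremal_cubic order_ten_cubic by auto
  \<comment> \<open>The recognised copy is closed under neighbours and meets the component
    \<open>C\<close>, so it contains \<open>v\<close>, where the eigenvector does not
    vanish.\<close>
  obtain u where "u \<in> set ws" "u \<in> C" using K(3) H(3) by blast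
  then have "v \<in> set ws"
    using rtrancl_closed[OF reach_v] embeds_closed[OF G K(2) cubic] by blast
  then have nz: "x v \<in> set (map x ws)" by simp
  have ev: "list_eigenvector K ?m (map x ws)"
    using embeds_list_eigenvector[OF G K(2) cubic x(3)] by simp
  show thesis
  proof (cases "K = extremal")
    case True
    then show thesis
      using extremal_eigenvalue[of ?m "map x ws"] ev less nz x(2) K(2) that by blast
  next
    case False
    then have K10: "K \<in> set order_ten" using K(1) by simp
    then have "length (map x ws) = 10"
      using ev order_ten_length by (simp add: list_eigenvector_def)
    from order_ten_form[OF K10 this] have "- 2 * sqnorm (map x ws) \<le> ?m * sqnorm (map x ws)"
      by (simp only: list_form_eigenvector[OF ev])
    then have False
      using mult_strict_right_mono[OF less sqnorm_pos[OF nz x(2)]] by linarith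
    then show thesis ..
  qed
qed

text \<open>By \<open>extremal_eigenvalue\<close> an eigenvalue below - 2 can only be
  \<open>beta\<close>, and the vector of \<open>extremal_beta\<close>, carried to the vertices
  through \<open>ws\<close>, shows that \<open>beta\<close> occurs.\<close>

lemma smallest_eigenvalue_extremal:
  assumes G: "regular_graph 3 G" and e: "embeds G extremal ws" and V: "set ws = pverts G"
  shows "smallest_eigenvalue G = beta"
proof -
  note G' = regular_graphD(1,2)[OF G]
  have len: "length ws = length extremal" using e by (simp add: embeds_def)
  have "beta \<le> c" if c: "c \<in> graph_eigenvalues G" for c
  proof (cases "c < - 2")
    case True
    obtain x v where x: "v \<in> pverts G" "x v \<noteq> 0" "\<And>v. v \<in> pverts G \<Longrightarrow> (\<Sum>u\<in>nbr G v. x u) = c * x v"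
      using c graph_eigenvalues_iff[OF G'(1)] by blast
    then show ?thesis
      using extremal_eigenvalue[OF embeds_list_eigenvector[OF G e extremal_cubic x(3)] True] V by auto
  next
    case False
    then show ?thesis using beta_less by simp
  qed
  moreover have "beta \<in> graph_eigenvalues G"
  proof -
    obtain y where y: "list_eigenvector extremal beta y" "y ! 1 = 1" by (rule extremal_beta)
    from y(1) have "length y = length extremal" by (simp add: list_eigenvector_def)
    then obtain x where x: "\<And>i. i < length extremal \<Longrightarrow> x (ws ! i) = y ! i"
      by (rule embeds_form[OF G'(1) e]) (rule that)
    have "(\<Sum>u\<in>nbr G v. x u) = beta * x v" if v: "v \<in> pverts G" for v
    proof -
      obtain i where i: "i < length extremal" "v = ws ! i"
        using v unfolding V[symmetric] in_set_conv_nth len by blast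
      have "(\<Sum>u\<in>nbr G v. x u) = (\<Sum>u\<in>nbr G (ws ! i) \<inter> set ws. x u)"
        using nbr_subset[OF G'(1)] V i by (simp add: Int_absorb2)
      also have "\<dots> = (\<Sum>j\<leftarrow>extremal ! i. x (ws ! j))"
        by (rule embeds_sum_nbr[OF e i(1)])
      also have "\<dots> = (\<Sum>j\<leftarrow>extremal ! i. y ! j)"
        using e i x by (intro arg_cong[where f = sum_list] map_cong) (auto simp: embeds_def subset_iff)
      also have "\<dots> = beta * x v"
        using y i x by (simp add: list_eigenvector_def)
      finally show ?thesis .
    qed
    moreover have "1 < length extremal" by (simp add: extremal_def)
    then have "ws ! 1 \<in> pverts G" "x (ws ! 1) \<noteq> 0"
      using x[of 1] y(2) nth_mem[of 1 ws] unfolding V len by simp_all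
    ultimately show ?thesis
      unfolding graph_eigenvalues_iff[OF G'(1)] by blast
  qed
  ultimately show ?thesis
    unfolding smallest_eigenvalue_def using finite_graph_eigenvalues[OF G'(1)] by (intro Min_eqI) auto
qed

section \<open>Connectedness, isomorphism and existence of the extremal graph\<close>

lemma symmetric_with_proj: "pair_graph G \<Longrightarrow> symmetric (with_proj G)"
  by (simp add: pair_graph_def pair_pseudo_graph_def pair_sym_digraph_def pair_sym_digraph_axioms_def)

lemma wf_with_proj: "pair_graph G \<Longrightarrow> wf_digraph (with_proj G)"
  using pair_wf_digraph.arc_fst_in_verts[of G] pair_wf_digraph.arc_snd_in_verts[of G]
  by (auto simp: wf_digraph_def pair_graph_def pair_digraph_def pair_fin_digraph_def)

lemma connected_with_proj_iff:
  assumes G: "pair_graph G"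
  shows "connected (with_proj G) \<longleftrightarrow>
    pverts G \<noteq> {} \<and> (\<forall>u\<in>pverts G. \<forall>v\<in>pverts G. (u, v) \<in> (parcs G)\<^sup>*)"
proof -
  have "u \<rightarrow>\<^sup>*\<^bsub>with_proj G\<^esub> v \<longleftrightarrow> (u, v) \<in> (parcs G)\<^sup>*" if "u \<in> pverts G" for u v
    using wf_digraph.reachable_conv'[OF wf_with_proj[OF G], of u v] that by simp
  then show ?thesis
    using wf_digraph.reachable_mk_symmetric_eq[OF wf_with_proj[OF G] symmetric_with_proj[OF G]]
    by (simp add: connected_def strongly_connected_def)
qed

lemma embeds_extremal_spanning:
  assumes G: "regular_graph 3 G" and conn: "connected (with_proj G)" and e: "embeds G extremal ws"
  shows "set ws = pverts G"
proof
  show "set ws \<subseteq> pverts G" using e by (simp add: embeds_def)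
  have "ws ! 0 \<in> set ws"
    using e by (auto simp: embeds_def extremal_def intro!: nth_mem)
  then show "pverts G \<subseteq> set ws"
    using conn rtrancl_closed[of "ws ! 0" _ G "set ws"] embeds_closed[OF G e extremal_cubic]
      \<open>set ws \<subseteq> pverts G\<close>
    unfolding connected_with_proj_iff[OF regular_graphD(1)[OF G]] by blast
qed

text \<open>Both arc sets are images of the same set of index pairs read off from \<open>K\<close>,
  so sending \<open>vs ! i\<close> to \<open>ws ! i\<close> is an isomorphism.\<close>

lemma embeds_spanning_iso:
  assumes G: "pair_graph G" "embeds G K vs" "set vs = pverts G"
    and H: "pair_graph H" "embeds H K ws" "set ws = pverts H"
  shows "digraph_iso (with_proj G) (with_proj H)"
proof -
  have len: "length vs = length K" "length ws = length K" and dist: "distinct vs" "distinct ws"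
    using G H by (auto simp: embeds_def)
  define f where "f v = ws ! the_inv_into {..<length vs} ((!) vs) v" for v
  have f: "f (vs ! i) = ws ! i" if "i < length K" for i
    using that len dist by (simp add: f_def the_inv_into_f_f inj_on_nth)
  have arcs: "parcs X = (\<lambda>(i, j). (xs ! i, xs ! j)) ` (SIGMA i:{..<length K}. set (K ! i))"
    if X: "pair_graph X" "embeds X K xs" "set xs = pverts X" for X :: "'c pair_pre_digraph" and xs
  proof -
    have nbr: "nbr X (xs ! i) = (!) xs ` set (K ! i)" if "i < length K" for i
      using X nbr_subset[OF X(1), of "xs ! i"] that by (auto simp: embeds_def Int_absorb2)
    have len_xs: "length xs = length K" using X(2) by (simp add: embeds_def)
    show ?thesis
    proof (intro equalityI subsetI)
      fix a assume a: "a \<in> parcs X"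
      obtain u w where uw: "a = (u, w)" by (cases a)
      have "u \<in> set xs"
        using a uw X(3) nbr_subset[OF X(1), of w] arcs_sym[OF X(1)] by (auto simp: nbr_def)
      then obtain i where i: "i < length K" "u = xs ! i"
        unfolding in_set_conv_nth len_xs by blast
      moreover have "w \<in> nbr X u" using a uw by (simp add: nbr_def)
      ultimately obtain j where "j \<in> set (K ! i)" "w = xs ! j" using nbr by blast
      with i uw show "a \<in> (\<lambda>(i, j). (xs ! i, xs ! j)) ` (SIGMA i:{..<length K}. set (K ! i))"
        by (intro image_eqI[of _ _ "(i, j)"]) auto
    next
      fix a assume "a \<in> (\<lambda>(i, j). (xs ! i, xs ! j)) ` (SIGMA i:{..<length K}. set (K ! i))"
      then obtain i j where "i < length K" "j \<in> set (K ! i)" "a = (xs ! i, xs ! j)" by auto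
      with nbr[of i] have "snd a \<in> nbr X (xs ! i)" by auto
      with \<open>a = _\<close> show "a \<in> parcs X" by (simp add: nbr_def)
    qed
  qed
  have "map f vs = ws"
    using f len by (intro nth_equalityI) auto
  then have verts: "pverts H = f ` pverts G"
    using G(3) H(3) by (metis set_map)
  have inj: "inj_on f (pverts G)"
  proof (rule inj_onI)
    fix u v assume uv: "u \<in> pverts G" "v \<in> pverts G" "f u = f v"
    obtain i j where "i < length K" "u = vs ! i" "j < length K" "v = vs ! j"
      using uv(1,2) unfolding G(3)[symmetric] in_set_conv_nth len by blast
    then show "u = v" using uv(3) f dist len by (simp add: nth_eq_iff_index_eq)
  qed
  have less: "j < length K" if "i < length K" "j \<in> set (K ! i)" for i j
    using G(2) that by (auto simp: embeds_def)
  have parcs_H: "parcs H = map_prod f f ` parcs G"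
    unfolding arcs[OF G] arcs[OF H] image_image
    by (intro image_cong refl) (use f less in auto)
  \<comment> \<open>A digraph isomorphism also carries an arc map and the new end maps; as arcs are
    pairs, these are \<open>map_prod f f\<close> and the projections.\<close>
  define h where "h = \<lparr>iso_verts = f, iso_arcs = map_prod f f, iso_head = snd, iso_tail = fst\<rparr>"
  have wf: "parcs G \<subseteq> pverts G \<times> pverts G"
    using wf_digraph.tail_in_verts[OF wf_with_proj[OF G(1)]] wf_digraph.head_in_verts[OF wf_with_proj[OF G(1)]]
    by fastforce
  have "pre_digraph.digraph_isomorphism (with_proj G) h"
    unfolding pre_digraph.digraph_isomorphism_def
    using wf_with_proj[OF G(1)] inj inj_on_subset[OF map_prod_inj_on[OF inj inj] wf]
    by (simp add: h_def)
  moreover have "with_proj H = app_iso h (with_proj G)"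
    by (simp add: with_proj_def app_iso_def h_def verts parcs_H)
  ultimately show ?thesis
    unfolding digraph_iso_def by blast
qed

lemma extremal_graph_exists:
  obtains G :: "'a :: infinite pair_pre_digraph" and ws where
    "regular_graph 3 G" "connected (with_proj G)" "embeds G extremal ws" "set ws = pverts G"
proof -
  obtain f :: "nat \<Rightarrow> 'a" where f: "inj f"
    using infinite_countable_subset[OF infinite_UNIV] by blast
  define n where "n = length extremal"
  define G where "G = \<lparr>pverts = f ` {..<n}, parcs = (\<Union>i<n. \<Union>j\<in>set (extremal ! i). {(f i, f j)})\<rparr>"
  have ext: "\<forall>i<n. distinct (extremal ! i) \<and> (\<forall>j\<in>set (extremal ! i). j < n \<and> i \<in> set (extremal ! j) \<and> i \<noteq> j)"
    unfolding n_def by code_simp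
  \<comment> \<open>Every vertex except 0 has a neighbour with a smaller number, which gives
    connectedness by the induction in \<open>from0\<close>.\<close>
  have pred: "\<forall>i<n. i \<noteq> 0 \<longrightarrow> (\<exists>j\<in>set (extremal ! i). j < i)"
    unfolding n_def by code_simp
  have len3: "length (extremal ! i) = 3" if "i < n" for i
    using that extremal_cubic by (simp add: n_def)
  have arc_iff: "(u, v) \<in> parcs G \<longleftrightarrow> (\<exists>i<n. \<exists>j\<in>set (extremal ! i). u = f i \<and> v = f j)" for u v
    by (auto simp: G_def)
  have nbr: "nbr G (f i) = f ` set (extremal ! i)" if "i < n" for i
    using that f by (auto simp: nbr_def G_def inj_eq)
  have graph: "pair_graph G"
  proof unfold_locales
    show "finite (pverts G)" "finite (parcs G)" by (auto simp: G_def)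
    show "symmetric (with_proj G)"
      unfolding symmetric_def with_proj_simps
      by (rule symI) (metis arc_iff ext)
    fix e assume e: "e \<in> parcs G"
    then obtain i j where ij: "i < n" "j \<in> set (extremal ! i)" "e = (f i, f j)"
      by (auto simp: G_def)
    then have "j < n" "i \<noteq> j" using ext by blast+
    then show "fst e \<in> pverts G" "snd e \<in> pverts G" "fst e \<noteq> snd e"
      using ij f by (auto simp: G_def inj_eq)
  qed
  have reg: "regular_graph 3 G"
    unfolding regular_graph_def
  proof (intro conjI ballI graph)
    show "pverts G \<noteq> {}" by (auto simp: G_def n_def extremal_def)
    fix v assume "v \<in> pverts G"
    then obtain i where i: "i < n" "v = f i" by (auto simp: G_def)
    have "card (nbr G v) = card (set (extremal ! i))"
      unfolding i nbr[OF i(1)] using f by (intro card_image) (auto intro: inj_on_subset)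
    also have "\<dots> = 3"
      using distinct_card[of "extremal ! i"] ext i(1) len3[OF i(1)] by metis
    finally show "card {u. (v, u) \<in> parcs G} = 3" by (simp add: nbr_def)
  qed
  have emb: "embeds G extremal (map f [0..<n])"
    unfolding embeds_def
  proof (intro conjI allI impI)
    fix i assume i: "i < length extremal"
    then have i': "i < n" by (simp add: n_def)
    have sub: "set (extremal ! i) \<subseteq> {..<n}" using ext i' by blast
    then show "set (extremal ! i) \<subseteq> {..<length extremal}" by (simp add: n_def)
    show "distinct (extremal ! i)" using ext i' by blast
    have "f ` set (extremal ! i) = (!) (map f [0..<n]) ` set (extremal ! i)"
      using sub by (intro image_cong) auto
    then show "nbr G (map f [0..<n] ! i) \<inter> set (map f [0..<n]) = (!) (map f [0..<n]) ` set (extremal ! i)"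
      using nbr[OF i'] i' sub by auto
  qed (use f in \<open>auto simp: n_def G_def distinct_map intro: inj_on_subset\<close>)
  have from0: "(f 0, f i) \<in> (parcs G)\<^sup>*" if "i < n" for i
    using that
  proof (induction i rule: less_induct)
    case (less i)
    show ?case
    proof (cases "i = 0")
      case False
      then obtain j where j: "j \<in> set (extremal ! i)" "j < i" using pred less.prems by blast
      then have "j < n" "i \<in> set (extremal ! j)" using ext less.prems by blast+
      then have "(f j, f i) \<in> parcs G" by (auto simp: G_def)
      with less.IH[OF j(2)] j(2) less.prems show ?thesis by (auto intro: rtrancl_into_rtrancl)
    qed simp
  qed
  have "sym ((parcs G)\<^sup>*)"
    using arcs_sym[OF graph] by (intro sym_rtrancl symI)
  then have "connected (with_proj G)"
    unfolding connected_with_proj_iff[OF graph]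
    using from0 regular_graphD(2)[OF reg] by (auto simp: G_def dest: symD intro: rtrancl_trans)
  with reg emb show thesis by (intro that) (auto simp: G_def)
qed

theorem theorem4p2:
  shows "Sup {smallest_eigenvalue G | G :: 'a :: infinite pair_pre_digraph.
                regular_graph 3 G \<and> smallest_eigenvalue G < -2} = beta
    \<and> (\<exists>G :: 'a pair_pre_digraph.
          (regular_graph 3 G \<and> connected (with_proj G) \<and> smallest_eigenvalue G = beta)
        \<and> (\<forall>H :: 'a pair_pre_digraph.
              regular_graph 3 H \<and> connected (with_proj H) \<and> smallest_eigenvalue H = beta
                \<longrightarrow> digraph_iso (with_proj G) (with_proj H)))"
proof -
  obtain G :: "'a pair_pre_digraph" and ws where
    G: "regular_graph 3 G" "connected (with_proj G)" "embeds G extremal ws" "set ws = pverts G"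
    by (rule extremal_graph_exists)
  have G_beta: "smallest_eigenvalue G = beta"
    by (rule smallest_eigenvalue_extremal[OF G(1,3,4)])
  \<comment> \<open>A value above \<open>beta\<close> would satisfy the hypotheses of
    \<open>smallest_eigenvalue_gap\<close> and hence equal \<open>beta\<close>. Since
    \<open>G\<close> attains this bound, the supremum is a maximum.\<close>
  have "smallest_eigenvalue H \<le> beta"
    if "regular_graph 3 H" "smallest_eigenvalue H < -2" for H :: "'a pair_pre_digraph"
    using smallest_eigenvalue_gap[OF that] by fastforce
  then have "Sup {smallest_eigenvalue G | G :: 'a pair_pre_digraph.
      regular_graph 3 G \<and> smallest_eigenvalue G < -2} = beta"
    using G(1) G_beta beta_less
    by (intro cSup_eq_maximum CollectI exI[of _ G]) auto
  moreover have "digraph_iso (with_proj G) (with_proj H)"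
    if H: "regular_graph 3 H" "connected (with_proj H)" "smallest_eigenvalue H = beta"
    for H :: "'a pair_pre_digraph"
  proof -
    obtain vs where vs: "embeds H extremal vs"
      using smallest_eigenvalue_gap[OF H(1)] H(3) beta_less by auto
    show ?thesis
      using embeds_spanning_iso[OF regular_graphD(1)[OF G(1)] G(3,4) regular_graphD(1)[OF H(1)] vs
          embeds_extremal_spanning[OF H(1,2) vs]] .
  qed
  ultimately show ?thesis using G(1,2) G_beta by blast
qed

end
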